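(* Let $k$ be an algebraically closed field, let $n\geq 2$, and let $\Gamma$ be a set of $n+2$ distinct points in hyperplane linear position in $\mathbb{P}^n=\mathbb{P}^n_k$. Let $J\subset R=k[x_0,\ldots,x_n]$ denote the homogeneous defining ideal of $\Gamma$, let $\Theta$ be the Jacobian matrix of a minimal set of homogeneous generators of $J$, and let $I_n(\Theta)$ be the ideal generated by the $n\times n$ minors of $\Theta$. Then the pair $J\subset (J,I_n(\Theta))$ is torsion-free.
   Context: $R=k[x_0,\ldots,x_n]$ is the standard graded polynomial ring. The defining ideal of a finite set of points $\Gamma\subset\mathbb{P}^n_k$ is $J=\bigcap_{p\in\Gamma} I(p)$, where $I(p)$ is the homogeneous prime ideal of $p$. A set of $s$ distinct points of $\mathbb{P}^m$ is in general linear position if either $s\leq m$ and the points span a $\mathbb{P}^{s-1}$, or $s\geq m+1$ and no subset of $m+1$ of the points is contained in a hyperplane of $\mathbb{P}^m$. A set $\Gamma$ of $s\geq n+2$ distinct points in $\mathbb{P}^n$ is in hyperplane linear position if it admits $s-1$ points that span a hyperplane $H\subset\mathbb{P}^n$ and are in general linear position as points of $\mathbb{P}^{n-1}\simeq H$, while the remaining point of $\Gamma$ lies outside $H$. A pair of ideals $J\subset I$ of $R$ is called (Aluffi) torsion-free if its Valabrega--Valla module $\bigoplus_{t\geq 2}\frac{J\cap I^t}{JI^{t-1}}$ is zero, i.e. if $J\cap I^t=JI^{t-1}$ for every $t\geq 2$. *)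

theory Defs
  imports
    "HOL-Library.Poly_Mapping"
    "HOL-Computational_Algebra.Polynomial"
    "HOL-Analysis.Cartesian_Space"
    "Jordan_Normal_Form.Determinant"
begin

section \<open>The polynomial ring\<close>

text \<open>
  The variables are the elements of a finite type \<open>'v\<close>: with \<open>CARD('v) = n + 1\<close>, the whole type
  \<open>('v, 'k) mpoly\<close> is the ring \<open>k[x\<^sub>0, \<dots>, x\<^sub>n]\<close>, and \<open>'k ^ 'v\<close> is the space \<open>k\<^bsup>n+1\<^esup>\<close>
  whose lines are the points of \<open>P\<^sup>n\<close>.
\<close>

type_synonym ('v, 'k) mpoly = "('v \<Rightarrow>\<^sub>0 nat) \<Rightarrow>\<^sub>0 'k"

definition eval_mpoly :: "('v::finite, 'k::comm_ring_1) mpoly \<Rightarrow> 'k ^ 'v \<Rightarrow> 'k" where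
  "eval_mpoly F a = (\<Sum>m\<in>Poly_Mapping.keys F.
     Poly_Mapping.lookup F m * (\<Prod>v\<in>UNIV. (a $ v) ^ Poly_Mapping.lookup m v))"

definition homogeneous :: "nat \<Rightarrow> ('v::finite, 'k::comm_ring_1) mpoly \<Rightarrow> bool" where
  "homogeneous d F \<longleftrightarrow>
     (\<forall>m\<in>Poly_Mapping.keys F. (\<Sum>v\<in>UNIV. Poly_Mapping.lookup m v) = d)"

text \<open>
  The subtraction of exponents is truncated, but wherever it truncates the coefficient
  \<open>of_nat (lookup m v)\<close> is zero.
\<close>

definition pdiff :: "'v::finite \<Rightarrow> ('v, 'k::comm_ring_1) mpoly \<Rightarrow> ('v, 'k) mpoly" where
  "pdiff v F = (\<Sum>m\<in>Poly_Mapping.keys F.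
     Poly_Mapping.single (m - Poly_Mapping.single v 1)
       (of_nat (Poly_Mapping.lookup m v) * Poly_Mapping.lookup F m))"


section \<open>Ideals\<close>

text \<open>
  The ideals of a commutative ring are its submodules: below, \<open>ideal.span S\<close> is the ideal generated
  by \<open>S\<close>, and \<open>ideal.subspace I\<close> says that \<open>I\<close> is an ideal.
\<close>

global_interpretation ideal: Modules.module "(*) :: 'a::comm_ring_1 \<Rightarrow> 'a \<Rightarrow> 'a"
  by unfold_locales (auto simp: algebra_simps)

definition ideal_mult :: "'a::comm_ring_1 set \<Rightarrow> 'a set \<Rightarrow> 'a set" where
  "ideal_mult I K = ideal.span {a * b | a b. a \<in> I \<and> b \<in> K}"

primrec ideal_pow :: "'a::comm_ring_1 set \<Rightarrow> nat \<Rightarrow> 'a set" where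
  "ideal_pow I 0 = UNIV"
| "ideal_pow I (Suc t) = ideal_mult I (ideal_pow I t)"

text \<open>
  The vanishing of all the graded components \<open>(J \<inter> I\<^sup>t) / (J I\<^bsup>t-1\<^esup>)\<close>, \<open>t \<ge> 2\<close>,
  of the Valabrega--Valla module.
\<close>

definition aluffi_torsion_free :: "'a::comm_ring_1 set \<Rightarrow> 'a set \<Rightarrow> bool" where
  "aluffi_torsion_free J I \<longleftrightarrow>
     ideal.subspace J \<and> ideal.subspace I \<and> J \<subseteq> I \<and>
     (\<forall>t\<ge>2. J \<inter> ideal_pow I t = ideal_mult J (ideal_pow I (t - 1)))"

definition minimal_homogeneous_generators ::
    "('v::finite, 'k::comm_ring_1) mpoly set \<Rightarrow> ('v, 'k) mpoly set \<Rightarrow> bool" where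
  "minimal_homogeneous_generators G J \<longleftrightarrow>
     finite G \<and> (\<forall>F\<in>G. \<exists>d. homogeneous d F) \<and> ideal.span G = J \<and>
     (\<forall>G'. G' \<subset> G \<longrightarrow> ideal.span G' \<noteq> J)"


section \<open>Jacobian matrix and ideals of minors\<close>

text \<open>
  The rows of the Jacobian matrix are indexed by the generators themselves and its columns by the
  variables.
\<close>

definition jacobian :: "('v::finite, 'k::comm_ring_1) mpoly \<Rightarrow> 'v \<Rightarrow> ('v, 'k) mpoly" where
  "jacobian F v = pdiff v F"

text \<open>
  A \<open>t \<times> t\<close> minor of a matrix with row set \<open>A\<close> and column set \<open>B\<close> is given by \<open>t\<close> distinct rows
  and \<open>t\<close> distinct columns. They are enumerated here in all possible orders, as \<open>A\<close> and \<open>B\<close> are not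
  ordered; a change of order only affects the sign of the minor, hence not the ideal.
\<close>

definition minors :: "nat \<Rightarrow> 'r set \<Rightarrow> 'c set \<Rightarrow> ('r \<Rightarrow> 'c \<Rightarrow> 'a::comm_ring_1) \<Rightarrow> 'a set" where
  "minors t A B M =
     {Determinant.det (Matrix.mat t t (\<lambda>(i, j). M (\<rho> i) (\<gamma> j))) | \<rho> \<gamma>.
        inj_on \<rho> {..<t} \<and> \<rho> ` {..<t} \<subseteq> A \<and> inj_on \<gamma> {..<t} \<and> \<gamma> ` {..<t} \<subseteq> B}"

definition minors_ideal :: "nat \<Rightarrow> 'r set \<Rightarrow> 'c set \<Rightarrow> ('r \<Rightarrow> 'c \<Rightarrow> 'a::comm_ring_1) \<Rightarrow> 'a set" where
  "minors_ideal t A B M = ideal.span (minors t A B M)"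


section \<open>Points of projective space\<close>

text \<open>
  A linear subspace of projective space is represented by the linear subspace \<open>W\<close> of \<open>'k ^ 'v\<close> it
  comes from, so that its projective dimension is \<open>vec.dim W - 1\<close>. In particular a point is a line
  through the origin, it lies in \<open>W\<close> iff it is a subset of \<open>W\<close>, and the projective span of a set
  \<open>S\<close> of points is \<open>vec.span (\<Union>S)\<close>.
\<close>

definition points_of :: "('k::field ^ 'v::finite) set \<Rightarrow> ('k ^ 'v) set set" where
  "points_of W = {p. vec.subspace p \<and> vec.dim p = 1 \<and> p \<subseteq> W}"

definition hyperplane_of :: "('k::field ^ 'v::finite) set \<Rightarrow> ('k ^ 'v) set \<Rightarrow> bool" where
  "hyperplane_of W H \<longleftrightarrow> vec.subspace H \<and> H \<subseteq> W \<and> vec.dim H + 1 = vec.dim W"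

text \<open>General linear position in the projective space \<open>P\<^sup>m\<close> of \<open>W\<close>.\<close>

definition general_linear_position ::
    "('k::field ^ 'v::finite) set \<Rightarrow> ('k ^ 'v) set set \<Rightarrow> bool" where
  "general_linear_position W S \<longleftrightarrow>
     finite S \<and> S \<subseteq> points_of W \<and>
     (let m = vec.dim W - 1; s = card S in
        s \<le> m \<and> vec.dim (vec.span (\<Union>S)) = s \<or>
        s \<ge> m + 1 \<and> (\<forall>T\<subseteq>S. card T = m + 1 \<longrightarrow> \<not> (\<exists>H. hyperplane_of W H \<and> \<Union>T \<subseteq> H)))"

text \<open>In \<open>P\<^sup>n\<close>, where \<open>n + 2 = CARD('v) + 1\<close>.\<close>

definition hyperplane_linear_position :: "('k::field ^ 'v::finite) set set \<Rightarrow> bool" where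
  "hyperplane_linear_position \<Gamma> \<longleftrightarrow>
     finite \<Gamma> \<and> \<Gamma> \<subseteq> points_of UNIV \<and> card \<Gamma> \<ge> CARD('v) + 1 \<and>
     (\<exists>p\<in>\<Gamma>. \<exists>H. hyperplane_of UNIV H \<and> vec.span (\<Union>(\<Gamma> - {p})) = H \<and>
        general_linear_position H (\<Gamma> - {p}) \<and> \<not> p \<subseteq> H)"

definition point_ideal :: "('k::field ^ 'v::finite) set \<Rightarrow> ('v, 'k) mpoly set" where
  "point_ideal p = ideal.span {F. (\<exists>d. homogeneous d F) \<and> (\<forall>a\<in>p. eval_mpoly F a = 0)}"

definition defining_ideal :: "('k::field ^ 'v::finite) set set \<Rightarrow> ('v, 'k) mpoly set" where
  "defining_ideal \<Gamma> = (\<Inter>p\<in>\<Gamma>. point_ideal p)"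

end

theory Submission
  imports Defs
begin

text \<open>
  Two choices make the proof short: coordinates adapted to \<open>\<Gamma>\<close>, and a weight filtration
  \<open>W\<close> of \<open>R\<close> that describes \<open>I = (J, I\<^sub>n(\<Theta>))\<close> modulo \<open>J\<close> as the ideal of elements of high weight.

  \<^emph>\<open>Coordinates.\<close> The \<open>n + 2\<close> points can be moved by a linear automorphism to the
  vertices \<open>e\<^sub>v\<close> of the coordinate simplex together with the point \<open>u\<close> whose coordinates are all
  \<open>1\<close>, except for a \<open>0\<close> at one variable \<open>z\<close> (\<open>hyperplane_linear_position_obtains_frame\<close>); the point
  off the hyperplane becomes \<open>e\<^sub>z\<close>. The variables other than \<open>z\<close>, coordinates of the hyperplane, are
  called base variables below. Since the determinant is multilinear and the partial derivatives
  form a basis of the derivations of \<open>R\<close>, the ideal \<open>(J, I\<^sub>n(\<Theta>))\<close> is spanned by \<open>J\<close> and all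
  \<open>det (\<delta>\<^sub>j f\<^sub>i)\<close> with \<open>f\<^sub>i \<in> J\<close> and \<open>\<delta>\<^sub>j\<close> derivations (\<open>span_minors_eq_jac_ideal\<close>). So it depends on
  \<open>J\<close> alone and is carried along by automorphisms (\<open>jac_ideal_image\<close>).

  \<^emph>\<open>Filtration.\<close> For \<open>n \<ge> 3\<close> the key fact is that \<open>(J, I\<^sub>n(\<Theta>)) = J + \<mm>\<^sup>n\<close>, where \<open>\<mm>\<close> is the
  irrelevant ideal. For \<open>n = 2\<close> this fails, because three points on a line need a cubic equation, but
  it becomes true again once the variable \<open>z\<close> gets weight \<open>3\<close>, the other two get weight \<open>2\<close>, and
  \<open>\<mm>\<^sup>n\<close> is replaced by the ideal of all elements of weight at least \<open>6\<close>. Both cases are treated at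
  once: with \<open>e = 3\<close> for \<open>n = 2\<close> and \<open>e = n\<close> otherwise, \<open>z\<close> has weight \<open>e\<close>, the other variables have
  weight \<open>n\<close>, \<open>W d\<close> is spanned by the monomials of weight at least \<open>d\<close>, and \<open>I = J + W D\<close> for
  \<open>D = n * e\<close> (\<open>jac_ideal_frame_eq\<close>).

  \<^emph>\<open>Conclusion.\<close> From \<open>I = J + W D\<close> one gets \<open>I\<^sup>t \<subseteq> J I\<^bsup>t-1\<^esup> + W (D t)\<close>. As \<open>J\<close> is generated by
  elements that are homogeneous of weight at most \<open>D\<close>,
  \<open>J \<inter> W (D t) \<subseteq> J W (D (t - 1))\<close> (\<open>frame_ideal_Int_filt\<close>), and
  \<open>W (D (t - 1)) \<subseteq> I\<^bsup>t-1\<^esup>\<close> (\<open>filt_subset_jac_ideal_pow\<close>). Hence \<open>J \<inter> I\<^sup>t = J I\<^bsup>t-1\<^esup>\<close>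
  (\<open>torsion_free_if_filtration\<close>).
\<close>

section \<open>Ideals\<close>

text \<open>
  The simplification rule \<open>a * (b * x) = (a * b) * x\<close>, inherited from modules, loops together with
  associativity and commutativity of multiplication.
\<close>
declare ideal.scale_scale [simp del]

lemma ideal_mult_memI: "a \<in> I \<Longrightarrow> b \<in> K \<Longrightarrow> a * b \<in> ideal_mult I K"
  unfolding ideal_mult_def by (rule ideal.span_base) blast

lemma subspace_ideal_mult [simp]: "ideal.subspace (ideal_mult I K)"
  unfolding ideal_mult_def by simp

lemma ideal_mult_least:
  assumes "ideal.subspace L" and "\<And>a b. a \<in> I \<Longrightarrow> b \<in> K \<Longrightarrow> a * b \<in> L"
  shows "ideal_mult I K \<subseteq> L"
  unfolding ideal_mult_def by (rule ideal.span_minimal) (use assms in auto)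

lemma subspace_ideal_pow [simp]: "ideal.subspace (ideal_pow I t)"
  by (cases t) auto

lemma ideal_mult_mono: "K \<subseteq> L \<Longrightarrow> ideal_mult I K \<subseteq> ideal_mult I L"
  by (intro ideal_mult_least) (auto intro: ideal_mult_memI)

lemma ideal_scale_right: "ideal.subspace I \<Longrightarrow> a \<in> I \<Longrightarrow> a * c \<in> I"
  using ideal.subspace_scale[of I a c] by (simp add: mult.commute)

lemma ideal_mult_subset_left: "ideal.subspace I \<Longrightarrow> ideal_mult I K \<subseteq> I"
  by (intro ideal_mult_least) (auto intro: ideal_scale_right)

lemma ideal_mult_left_commute:
  assumes "a \<in> I" and "b \<in> ideal_mult J P"
  shows "a * b \<in> ideal_mult J (ideal_mult I P)"
proof -
  let ?L = "{b. a * b \<in> ideal_mult J (ideal_mult I P)}"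
  have "ideal.subspace ?L"
  proof (rule ideal.subspaceI)
    fix c x assume "x \<in> ?L"
    then have "c * (a * x) \<in> ideal_mult J (ideal_mult I P)"
      by - (rule ideal.subspace_scale[OF subspace_ideal_mult], simp)
    then show "c * x \<in> ?L" by (simp only: mem_Collect_eq mult.left_commute[of a c x])
  qed (auto simp: distrib_left intro: ideal.subspace_0 ideal.subspace_add)
  moreover have "x * y \<in> ?L" if "x \<in> J" "y \<in> P" for x y
    using ideal_mult_memI[OF that(1) ideal_mult_memI[OF assms(1) that(2)]]
    by (simp only: mem_Collect_eq mult.left_commute[of a x y])
  ultimately show ?thesis using ideal_mult_least[of ?L J P] assms(2) by blast
qed

lemma span_Un_cases:
  assumes "x \<in> ideal.span (A \<union> B)" "ideal.subspace A" "ideal.subspace B"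
  obtains a b where "a \<in> A" "b \<in> B" "x = a + b"
  using assms unfolding ideal.span_Un
  by (auto simp flip: ideal.span_eq_iff)

text \<open>
  The last hypothesis holds when \<open>J\<close> is generated by homogeneous elements of degree at most \<open>D\<close>
  for the grading that defines \<open>W\<close>. Expanding a product of \<open>t\<close> elements of \<open>J + W D\<close>, every term with a
  factor from \<open>J\<close> lies in \<open>J I\<^bsup>t-1\<^esup>\<close>, so an element of \<open>J \<inter> I\<^sup>t\<close> is, modulo \<open>J I\<^bsup>t-1\<^esup>\<close>, in
  \<open>J \<inter> W (D t) \<subseteq> J W (D (t - 1)) \<subseteq> J I\<^bsup>t-1\<^esup>\<close>.
\<close>
lemma torsion_free_if_filtration:
  fixes W :: "nat \<Rightarrow> 'a::comm_ring_1 set"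
  assumes J: "ideal.subspace J" and W: "\<And>d. ideal.subspace (W d)"
    and Wmult: "\<And>a b c d. a \<in> W c \<Longrightarrow> b \<in> W d \<Longrightarrow> a * b \<in> W (c + d)"
    and I: "I = ideal.span (J \<union> W D)"
    and pow: "\<And>s. W (D * s) \<subseteq> ideal_pow I s"
    and gen: "\<And>N. D \<le> N \<Longrightarrow> J \<inter> W N \<subseteq> ideal_mult J (W (N - D))"
  shows "aluffi_torsion_free J I"
proof -
  have subI: "ideal.subspace I" unfolding I by simp
  have JI: "J \<subseteq> I" and WI: "W D \<subseteq> I" unfolding I by (auto intro: ideal.span_base)
  have step: "ideal_pow I (Suc t) \<subseteq> ideal.span (ideal_mult J (ideal_pow I t) \<union> W (D * Suc t))" for t
  proof (induction t)
    case 0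
    show ?case unfolding ideal_pow.simps
    proof (rule ideal_mult_least)
      fix a b :: 'a assume "a \<in> I"
      then obtain j w where jw: "j \<in> J" "w \<in> W D" "a = j + w"
        using span_Un_cases[of a J "W D"] J W I by blast
      have "j * b \<in> ideal_mult J UNIV" using jw by (intro ideal_mult_memI) auto
      moreover have "w * b \<in> W (D * Suc 0)" using jw W by (auto intro: ideal_scale_right)
      ultimately show "a * b \<in> ideal.span (ideal_mult J UNIV \<union> W (D * Suc 0))"
        unfolding jw distrib_right by (intro ideal.span_add ideal.span_base UnI1 UnI2)
    qed simp
  next
    case (Suc t)
    let ?L = "ideal.span (ideal_mult J (ideal_pow I (Suc t)) \<union> W (D * Suc (Suc t)))"
    show ?case unfolding ideal_pow.simps(2)[of _ "Suc t"]
    proof (rule ideal_mult_least)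
      fix a b assume a: "a \<in> I" and b: "b \<in> ideal_pow I (Suc t)"
      obtain j w where jw: "j \<in> J" "w \<in> W D" "a = j + w"
        using span_Un_cases[of a J "W D"] J W I a by blast
      obtain c v where cv: "c \<in> ideal_mult J (ideal_pow I t)" "v \<in> W (D * Suc t)" "b = c + v"
        using span_Un_cases[OF subsetD[OF Suc b] subspace_ideal_mult W] by blast
      have "j * b \<in> ideal_mult J (ideal_pow I (Suc t))" using jw b by (intro ideal_mult_memI)
      moreover have "w * c \<in> ideal_mult J (ideal_pow I (Suc t))"
        using ideal_mult_left_commute[OF _ cv(1)] WI jw(2) by auto
      ultimately have 1: "j * b + w * c \<in> ideal_mult J (ideal_pow I (Suc t))"
        by (rule ideal.subspace_add[OF subspace_ideal_mult])
      have 2: "w * v \<in> W (D * Suc (Suc t))" using Wmult[OF jw(2) cv(2)] by simp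
      have 3: "a * b = (j * b + w * c) + w * v" unfolding jw cv by (simp add: algebra_simps)
      show "a * b \<in> ?L" unfolding 3
        by (intro ideal.span_add ideal.span_base UnI1[OF 1] UnI2[OF 2])
    qed simp
  qed
  have "J \<inter> ideal_pow I t = ideal_mult J (ideal_pow I (t - 1))" if t2: "t \<ge> 2" for t
  proof
    obtain s where t: "t = Suc s" using t2 by (cases t) auto
    show "ideal_mult J (ideal_pow I (t - 1)) \<subseteq> J \<inter> ideal_pow I t"
      unfolding t using JI J
      by (intro ideal_mult_least ideal.subspace_inter)
         (auto intro: ideal_mult_memI ideal_scale_right)
    show "J \<inter> ideal_pow I t \<subseteq> ideal_mult J (ideal_pow I (t - 1))"
    proof
      fix x assume x: "x \<in> J \<inter> ideal_pow I t"
      then obtain c v where cv: "c \<in> ideal_mult J (ideal_pow I s)" "v \<in> W (D * t)" "x = c + v"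
        using span_Un_cases[OF subsetD[OF step[of s]] subspace_ideal_mult W] t by blast
      have "c \<in> J" using cv(1) ideal_mult_subset_left[OF J] by blast
      then have "v \<in> J \<inter> W (D * t)"
        using x cv ideal.subspace_diff[OF J, of x c] by auto
      then have "v \<in> ideal_mult J (W (D * t - D))"
        using gen[of "D * t"] t by auto
      then have "v \<in> ideal_mult J (ideal_pow I s)"
        using ideal_mult_mono[OF pow[of s], of J] by (auto simp: t)
      then show "x \<in> ideal_mult J (ideal_pow I (t - 1))"
        using cv t by (auto intro: ideal.subspace_add)
    qed
  qed
  then show ?thesis unfolding aluffi_torsion_free_def using J subI JI by auto
qed

lemma image_ideal_span:
  assumes "comm_ring_hom \<phi>" "surj \<phi>"
  shows "\<phi> ` ideal.span S = ideal.span (\<phi> ` S)"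
proof
  interpret comm_ring_hom \<phi> by fact
  have "ideal.subspace {x. \<phi> x \<in> ideal.span (\<phi> ` S)}"
    by (rule ideal.subspaceI) (auto simp: hom_distribs intro: ideal.span_zero ideal.span_add ideal.span_scale)
  then have "ideal.span S \<subseteq> {x. \<phi> x \<in> ideal.span (\<phi> ` S)}"
    by (intro ideal.span_minimal) (auto intro: ideal.span_base)
  then show "\<phi> ` ideal.span S \<subseteq> ideal.span (\<phi> ` S)" by blast
  show "ideal.span (\<phi> ` S) \<subseteq> \<phi> ` ideal.span S"
  proof (rule ideal.span_minimal)
    show "ideal.subspace (\<phi> ` ideal.span S)"
    proof (rule ideal.subspaceI)
      show "0 \<in> \<phi> ` ideal.span S" using ideal.span_zero[of S] by (force intro: image_eqI[of _ _ 0])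
      show "x + y \<in> \<phi> ` ideal.span S" if "x \<in> \<phi> ` ideal.span S" "y \<in> \<phi> ` ideal.span S" for x y
        using that by (auto simp flip: hom_add intro: ideal.span_add)
      show "c * x \<in> \<phi> ` ideal.span S" if "x \<in> \<phi> ` ideal.span S" for c x
      proof -
        obtain c' where "c = \<phi> c'" using assms(2) by blast
        then show ?thesis using that by (auto simp flip: hom_mult intro: ideal.span_scale)
      qed
    qed
  qed (auto intro: ideal.span_base)
qed

lemma image_ideal_mult:
  assumes "comm_ring_hom \<phi>" "surj \<phi>"
  shows "\<phi> ` ideal_mult I K = ideal_mult (\<phi> ` I) (\<phi> ` K)"
proof -
  interpret comm_ring_hom \<phi> by fact
  have "\<phi> ` {a * b |a b. a \<in> I \<and> b \<in> K} = {a * b |a b. a \<in> \<phi> ` I \<and> b \<in> \<phi> ` K}"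
    by (force simp: hom_mult)
  then show ?thesis unfolding ideal_mult_def image_ideal_span[OF assms] by simp
qed

lemma image_ideal_pow:
  assumes "comm_ring_hom \<phi>" "surj \<phi>"
  shows "\<phi> ` ideal_pow I t = ideal_pow (\<phi> ` I) t"
  by (induction t) (use assms in \<open>auto simp: image_ideal_mult\<close>)

lemma aluffi_torsion_free_image:
  assumes \<phi>: "comm_ring_hom \<phi>" "bij \<phi>" and tf: "aluffi_torsion_free J I"
  shows "aluffi_torsion_free (\<phi> ` J) (\<phi> ` I)"
proof -
  have s: "surj \<phi>" and i: "inj \<phi>" using \<phi>(2) by (auto simp: bij_def)
  have sub: "ideal.subspace (\<phi> ` K)" if "ideal.subspace K" for K
    using image_ideal_span[OF \<phi>(1) s, of K] that by (metis ideal.span_eq_iff)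
  have "\<phi> ` J \<inter> ideal_pow (\<phi> ` I) t = ideal_mult (\<phi> ` J) (ideal_pow (\<phi> ` I) (t - 1))" if "t \<ge> 2" for t
    using tf that i unfolding aluffi_torsion_free_def
    by (simp flip: image_ideal_pow[OF \<phi>(1) s] image_ideal_mult[OF \<phi>(1) s] image_Int)
  then show ?thesis using tf sub unfolding aluffi_torsion_free_def by auto
qed

section \<open>Determinants and replacement of rows\<close>

text \<open>
  Matrices are given by functions so that a single row can be replaced by a function update.
\<close>
definition detf :: "nat \<Rightarrow> (nat \<Rightarrow> nat \<Rightarrow> 'a::comm_ring_1) \<Rightarrow> 'a" where
  "detf n M = Determinant.det (Matrix.mat n n (\<lambda>(i, j). M i j))"

lemma detf_cong: "(\<And>i j. i < n \<Longrightarrow> j < n \<Longrightarrow> M i j = N i j) \<Longrightarrow> detf n M = detf n N"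
  unfolding detf_def by (rule arg_cong[of _ _ det]) auto

lemma detf_transpose: "detf n (\<lambda>i j. M j i) = detf n M"
proof -
  have "Matrix.mat n n (\<lambda>(i, j). M j i) = transpose_mat (Matrix.mat n n (\<lambda>(i, j). M i j))"
    by auto
  then show ?thesis unfolding detf_def by (metis det_transpose mat_carrier)
qed

lemma detf_row_linear:
  assumes "k < n"
  obtains c where "\<And>r. detf n (M(k := r)) = (\<Sum>j<n. r j * c j)"
proof
  fix r
  let ?A = "\<lambda>r. Matrix.mat n n (\<lambda>(i, j). (M(k := r)) i j)"
  have del: "mat_delete (?A r) k j = mat_delete (?A undefined) k j" for j
    unfolding mat_delete_def by (rule eq_matI) auto
  have "detf n (M(k := r)) = (\<Sum>j<n. ?A r $$ (k, j) * cofactor (?A r) k j)"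
    unfolding detf_def by (rule laplace_expansion_row) (use assms in auto)
  also have "\<dots> = (\<Sum>j<n. r j * cofactor (?A undefined) k j)"
    unfolding cofactor_def del using assms by (intro sum.cong) auto
  finally show "detf n (M(k := r)) = (\<Sum>j<n. r j * cofactor (?A undefined) k j)" .
qed

text \<open>
  A set \<open>T\<close> of rows in the closure of \<open>S\<close>, as seen by linear functionals modulo \<open>I\<close>, can replace \<open>S\<close>
  row by row: by Laplace expansion the determinant is a linear functional of each single row. This is
  multilinearity in a form that allows the rows of \<open>T\<close> to be combinations of rows of \<open>S\<close> only modulo \<open>I\<close>.
\<close>
lemma detf_rows_in_ideal:
  assumes S: "\<And>M. (\<And>i. i < n \<Longrightarrow> M i \<in> S) \<Longrightarrow> detf n M \<in> I"
    and T: "\<And>r c. r \<in> T \<Longrightarrow> (\<And>s. s \<in> S \<Longrightarrow> (\<Sum>j<n. s j * c j) \<in> I) \<Longrightarrow> (\<Sum>j<n. r j * c j) \<in> I"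
    and M: "\<And>i. i < n \<Longrightarrow> M i \<in> T"
  shows "detf n M \<in> I"
proof -
  have "detf n M \<in> I"
    if "k \<le> n" "\<And>i. i < k \<Longrightarrow> M i \<in> T" "\<And>i. k \<le> i \<Longrightarrow> i < n \<Longrightarrow> M i \<in> S" for k M
    using that
  proof (induction k arbitrary: M)
    case 0
    then show ?case by (intro S) auto
  next
    case (Suc k)
    obtain c where c: "\<And>r. detf n (M(k := r)) = (\<Sum>j<n. r j * c j)"
      using detf_row_linear[of k n] Suc.prems(1) by auto
    have "(\<Sum>j<n. s j * c j) \<in> I" if "s \<in> S" for s
      unfolding c[symmetric] by (rule Suc.IH) (use Suc.prems that in auto)
    then have "detf n (M(k := M k)) \<in> I" unfolding c using T Suc.prems(2) by blast
    then show ?case by simp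
  qed
  from this[of n] M show ?thesis by simp
qed

lemma detf_upper_triangular:
  assumes "\<And>i j. j < i \<Longrightarrow> i < n \<Longrightarrow> M i j = 0"
  shows "detf n M = (\<Prod>i<n. M i i)"
proof -
  have "detf n M = prod_list (diag_mat (Matrix.mat n n (\<lambda>(i, j). M i j)))"
    unfolding detf_def by (rule det_upper_triangular[of _ n]) (use assms in \<open>auto simp: upper_triangular_def\<close>)
  also have "\<dots> = (\<Prod>i<n. M i i)"
    unfolding diag_mat_def prod_list_diag_prod by (simp add: prod.list_conv_set_nth atLeast0LessThan)
  finally show ?thesis .
qed

lemma minors_memI:
  assumes "inj_on \<rho> {..<t}" "\<rho> ` {..<t} \<subseteq> A" "inj_on \<gamma> {..<t}" "\<gamma> ` {..<t} \<subseteq> B"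
  shows "detf t (\<lambda>i j. M (\<rho> i) (\<gamma> j)) \<in> minors t A B M"
  unfolding minors_def detf_def using assms by blast

lemma detf_identical_rows:
  assumes "i < n" "j < n" "i \<noteq> j" "M i = M j"
  shows "detf n M = 0"
  unfolding detf_def
  by (rule det_identical_rows[of _ n i j]) (use assms in \<open>auto simp: Matrix.row_def\<close>)

section \<open>The polynomial ring as a free algebra\<close>

abbreviation Const :: "'k::comm_ring_1 \<Rightarrow> ('v, 'k) mpoly" where
  "Const c \<equiv> Poly_Mapping.single 0 c"

abbreviation Var :: "'v \<Rightarrow> ('v, 'k::comm_ring_1) mpoly" where
  "Var v \<equiv> Poly_Mapping.single (Poly_Mapping.single v (Suc 0)) 1"

lemma poly_mapping_sum_single:
  "F = (\<Sum>m\<in>Poly_Mapping.keys F. Poly_Mapping.single m (Poly_Mapping.lookup F m))"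
  by (rule poly_mapping_eqI)
     (auto simp: lookup_sum lookup_single when_def in_keys_iff)

lemma mpoly_induct_monomials:
  assumes "\<And>m c. P (Poly_Mapping.single m c)" and "\<And>F G. P F \<Longrightarrow> P G \<Longrightarrow> P (F + G)"
  shows "P (F :: 'a \<Rightarrow>\<^sub>0 'b::comm_monoid_add)"
proof -
  have "P (\<Sum>m\<in>A. Poly_Mapping.single m (Poly_Mapping.lookup F m))" if "finite A" for A
    using that
  proof induction
    case empty
    show ?case using assms(1)[of undefined 0] by simp
  qed (use assms in auto)
  from this[OF finite_keys, of F] show ?thesis by (simp flip: poly_mapping_sum_single)
qed

lemma Var_power: "Var v ^ k = (Poly_Mapping.single (Poly_Mapping.single v k) 1 :: ('v, 'k::comm_ring_1) mpoly)"
  by (induction k) (auto simp: mult_single simp flip: single_add)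

lemma prod_single: "finite A \<Longrightarrow>
  (\<Prod>v\<in>A. Poly_Mapping.single (m v) 1) = (Poly_Mapping.single (\<Sum>v\<in>A. m v) 1 :: ('v, 'k::comm_ring_1) mpoly)"
  by (induction A rule: finite_induct) (auto simp: mult_single)

lemma single_eq_prod_Var:
  fixes m :: "'v::finite \<Rightarrow>\<^sub>0 nat" and c :: "'k::comm_ring_1"
  shows "Poly_Mapping.single m c = Const c * (\<Prod>v\<in>UNIV. Var v ^ Poly_Mapping.lookup m v)"
proof -
  have "m = (\<Sum>v\<in>UNIV. Poly_Mapping.single v (Poly_Mapping.lookup m v))"
    by (rule poly_mapping_eqI) (auto simp: lookup_sum lookup_single when_def)
  then have "(\<Prod>v\<in>UNIV. Var v ^ Poly_Mapping.lookup m v) = (Poly_Mapping.single m 1 :: ('v, 'k) mpoly)"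
    unfolding Var_power by (subst prod_single) auto
  then show ?thesis by (simp add: mult_single)
qed

lemma mpoly_induct_algebra [case_names Const Var add mult]:
  fixes F :: "('v::finite, 'k::comm_ring_1) mpoly"
  assumes C: "\<And>c. P (Const c)" and V: "\<And>v. P (Var v)"
    and A: "\<And>F G. P F \<Longrightarrow> P G \<Longrightarrow> P (F + G)" and M: "\<And>F G. P F \<Longrightarrow> P G \<Longrightarrow> P (F * G)"
  shows "P F"
proof (rule mpoly_induct_monomials[of P])
  have pow: "P (G ^ k)" if "P G" for G k
    by (induction k) (use C[of 1] that M in auto)
  have "P (\<Prod>v\<in>B. Var v ^ k v)" if "finite B" for B and k :: "'v \<Rightarrow> nat"
    using that by (induction B rule: finite_induct) (use C[of 1] M pow V in auto)
  then show "P (Poly_Mapping.single m c)" for m c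
    by (subst single_eq_prod_Var) (intro M C, simp)
qed (rule A)

text \<open>
  The homomorphism out of the polynomial ring that is \<open>h\<close> on coefficients and \<open>y\<close> on variables;
  evaluation at a point and linear substitution are both of this kind.
\<close>
definition mpoly_hom ::
    "('k::comm_ring_1 \<Rightarrow> 'r::comm_ring_1) \<Rightarrow> ('v::finite \<Rightarrow> 'r) \<Rightarrow> ('v, 'k) mpoly \<Rightarrow> 'r" where
  "mpoly_hom h y F = (\<Sum>m\<in>Poly_Mapping.keys F.
     h (Poly_Mapping.lookup F m) * (\<Prod>v\<in>UNIV. y v ^ Poly_Mapping.lookup m v))"

lemma mpoly_hom_single:
  "h 0 = 0 \<Longrightarrow> mpoly_hom h y (Poly_Mapping.single m c) = h c * (\<Prod>v\<in>UNIV. y v ^ Poly_Mapping.lookup m v)"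
  by (simp add: mpoly_hom_def)

lemma comm_ring_hom_mpoly_hom:
  assumes "comm_ring_hom h"
  shows "comm_ring_hom (mpoly_hom h y)"
proof -
  interpret h: comm_ring_hom h by fact
  have add: "mpoly_hom h y (F + G) = mpoly_hom h y F + mpoly_hom h y G" for F G
    unfolding mpoly_hom_def
    by (rule setsum_keys_plus_distrib) (auto simp: h.hom_add algebra_simps)
  have mult: "mpoly_hom h y (F * G) = mpoly_hom h y F * mpoly_hom h y G" for F G
  proof (induction F rule: mpoly_induct_monomials)
    case (1 m c)
    show ?case
      by (induction G rule: mpoly_induct_monomials)
         (auto simp: mult_single mpoly_hom_single h.hom_mult lookup_add power_add prod.distrib
            distrib_left add)
  qed (simp add: distrib_right add)
  show ?thesis
    by unfold_locales (auto simp: add mult, auto simp: mpoly_hom_def)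
qed

lemma mpoly_hom_Const: "h 0 = 0 \<Longrightarrow> mpoly_hom h y (Const c) = h c"
  by (simp add: mpoly_hom_single)

lemma mpoly_hom_Var: "comm_ring_hom h \<Longrightarrow> mpoly_hom h y (Var v) = y v"
proof -
  assume "comm_ring_hom h"
  then interpret h: comm_ring_hom h .
  have "(\<Prod>w\<in>UNIV. y w ^ Poly_Mapping.lookup (Poly_Mapping.single v (Suc 0)) w) = (\<Prod>w\<in>UNIV. if w = v then y w else 1)"
    by (intro prod.cong) (auto simp: lookup_single)
  then show ?thesis by (simp add: mpoly_hom_single)
qed

lemma eval_mpoly_eq_hom: "eval_mpoly F a = mpoly_hom id (\<lambda>v. a $ v) F"
  by (simp add: eval_mpoly_def mpoly_hom_def)

lemma comm_ring_hom_id: "comm_ring_hom (id :: 'a::comm_ring_1 \<Rightarrow> 'a)"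
  by unfold_locales auto

lemma comm_ring_hom_eval: "comm_ring_hom (\<lambda>F. eval_mpoly F a)"
  unfolding eval_mpoly_eq_hom by (rule comm_ring_hom_mpoly_hom[OF comm_ring_hom_id])

lemma eval_Const [simp]: "eval_mpoly (Const c) a = c"
  by (simp add: eval_mpoly_eq_hom mpoly_hom_Const)

lemma eval_Var [simp]: "eval_mpoly (Var v) a = a $ v"
  unfolding eval_mpoly_eq_hom by (rule mpoly_hom_Var[OF comm_ring_hom_id])

lemma eval_single: "eval_mpoly (Poly_Mapping.single m c) a = c * (\<Prod>v\<in>UNIV. (a $ v) ^ Poly_Mapping.lookup m v)"
  by (simp add: eval_mpoly_eq_hom mpoly_hom_single)

lemma
  shows eval_add [simp]: "eval_mpoly (F + G) a = eval_mpoly F a + eval_mpoly G a"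
    and eval_mult [simp]: "eval_mpoly (F * G) a = eval_mpoly F a * eval_mpoly G a"
    and eval_diff [simp]: "eval_mpoly (F - G) a = eval_mpoly F a - eval_mpoly G a"
    and eval_zero [simp]: "eval_mpoly 0 a = 0"
    and eval_power [simp]: "eval_mpoly (F ^ k) a = eval_mpoly F a ^ k"
    and eval_sum: "eval_mpoly (sum f A) a = (\<Sum>i\<in>A. eval_mpoly (f i) a)"
proof -
  interpret comm_ring_hom "\<lambda>F. eval_mpoly F a" by (rule comm_ring_hom_eval)
  show "eval_mpoly (F + G) a = eval_mpoly F a + eval_mpoly G a" by (rule hom_add)
  show "eval_mpoly (F * G) a = eval_mpoly F a * eval_mpoly G a" by (rule hom_mult)
  show "eval_mpoly (F - G) a = eval_mpoly F a - eval_mpoly G a" by (rule hom_minus)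
  show "eval_mpoly 0 a = 0" by (rule hom_zero)
  show "eval_mpoly (F ^ k) a = eval_mpoly F a ^ k" by (rule hom_power)
  show "eval_mpoly (sum f A) a = (\<Sum>i\<in>A. eval_mpoly (f i) a)" by (rule hom_sum)
qed

section \<open>Linear substitutions\<close>

definition lin_subst :: "'k ^ 'v ^ 'v \<Rightarrow> ('v::finite, 'k::comm_ring_1) mpoly \<Rightarrow> ('v, 'k) mpoly" where
  "lin_subst A = mpoly_hom Const (\<lambda>v. \<Sum>w\<in>UNIV. Const (A $ v $ w) * Var w)"

lemma comm_ring_hom_Const: "comm_ring_hom (Const :: 'k \<Rightarrow> ('v, 'k::comm_ring_1) mpoly)"
  by unfold_locales (auto simp: single_add mult_single)

lemma comm_ring_hom_lin_subst: "comm_ring_hom (lin_subst A)"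
  unfolding lin_subst_def by (rule comm_ring_hom_mpoly_hom[OF comm_ring_hom_Const])

lemma lin_subst_Const [simp]: "lin_subst A (Const c) = Const c"
  by (simp add: lin_subst_def mpoly_hom_Const)

lemma lin_subst_Var: "lin_subst A (Var v) = (\<Sum>w\<in>UNIV. Const (A $ v $ w) * Var w)"
  unfolding lin_subst_def by (rule mpoly_hom_Var[OF comm_ring_hom_Const])

lemma eval_lin_subst: "eval_mpoly (lin_subst A F) a = eval_mpoly F (A *v a)"
proof -
  interpret comm_ring_hom "lin_subst A" by (rule comm_ring_hom_lin_subst)
  show ?thesis
    by (induction F rule: mpoly_induct_algebra)
       (auto simp: lin_subst_Var eval_sum hom_add hom_mult matrix_vector_mult_def)
qed

lemma lin_subst_compose:
  fixes A B :: "'k::comm_ring_1 ^ 'v::finite ^ 'v"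
  shows "lin_subst A (lin_subst B F) = lin_subst (B ** A) F"
proof -
  interpret A: comm_ring_hom "lin_subst A" by (rule comm_ring_hom_lin_subst)
  interpret B: comm_ring_hom "lin_subst B" by (rule comm_ring_hom_lin_subst)
  interpret AB: comm_ring_hom "lin_subst (B ** A)" by (rule comm_ring_hom_lin_subst)
  interpret C: comm_ring_hom "Const :: 'k \<Rightarrow> ('v, 'k) mpoly" by (rule comm_ring_hom_Const)
  show ?thesis
  proof (induction F rule: mpoly_induct_algebra)
    case (Var v)
    have CC: "Const (a * b) * F = Const a * (Const b * F)" for a b and F :: "('v, 'k) mpoly"
      by (simp only: C.hom_mult mult.assoc)
    have "lin_subst A (lin_subst B (Var v)) =
      (\<Sum>u\<in>UNIV. \<Sum>w\<in>UNIV. Const (B $ v $ u * A $ u $ w) * Var w)"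
      by (simp only: lin_subst_Var A.hom_sum A.hom_mult lin_subst_Const sum_distrib_left CC)
    also have "\<dots> = (\<Sum>w\<in>UNIV. \<Sum>u\<in>UNIV. Const (B $ v $ u * A $ u $ w) * Var w)"
      by (rule sum.swap)
    also have "\<dots> = lin_subst (B ** A) (Var v)"
      by (simp only: lin_subst_Var matrix_matrix_mult_def C.hom_sum sum_distrib_right vec_lambda_beta)
    finally show ?case .
  qed (auto simp: A.hom_add A.hom_mult B.hom_add B.hom_mult AB.hom_add AB.hom_mult)
qed

lemma lin_subst_id:
  fixes F :: "('v::finite, 'k::comm_ring_1) mpoly"
  shows "lin_subst (Finite_Cartesian_Product.mat 1) F = F"
proof -
  interpret comm_ring_hom "lin_subst (Finite_Cartesian_Product.mat 1 :: 'k ^ 'v ^ 'v)" by (rule comm_ring_hom_lin_subst)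
  show ?thesis
  proof (induction F rule: mpoly_induct_algebra)
    case (Var v)
    have "lin_subst (Finite_Cartesian_Product.mat 1) (Var v) = (\<Sum>w\<in>UNIV. if w = v then Var w else 0 :: ('v, 'k) mpoly)"
      unfolding lin_subst_Var by (intro sum.cong) (auto simp: Finite_Cartesian_Product.mat_def)
    then show ?case by simp
  qed (auto simp: hom_add hom_mult)
qed

section \<open>Derivations\<close>

definition derivation :: "(('v::finite, 'k::comm_ring_1) mpoly \<Rightarrow> ('v, 'k) mpoly) \<Rightarrow> bool" where
  "derivation \<delta> \<longleftrightarrow> (\<forall>F G. \<delta> (F + G) = \<delta> F + \<delta> G) \<and>
     (\<forall>F G. \<delta> (F * G) = F * \<delta> G + G * \<delta> F) \<and> (\<forall>c. \<delta> (Const c) = 0)"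

lemma pdiff_add: "pdiff v (F + G) = pdiff v F + pdiff v G"
  unfolding pdiff_def
  by (rule setsum_keys_plus_distrib) (auto simp: algebra_simps single_add)

lemma pdiff_single: "pdiff v (Poly_Mapping.single m c) =
    Poly_Mapping.single (m - Poly_Mapping.single v 1) (of_nat (Poly_Mapping.lookup m v) * c)"
  by (simp add: pdiff_def)

lemma derivation_pdiff: "derivation (pdiff v)"
proof -
  have sub: "m + k - Poly_Mapping.single v 1 = m + (k - Poly_Mapping.single v 1)"
    if "Poly_Mapping.lookup k v \<noteq> 0" for m k :: "'a \<Rightarrow>\<^sub>0 nat"
    using that by (intro poly_mapping_eqI) (auto simp: lookup_add lookup_minus lookup_single when_def)
  have mono: "Poly_Mapping.single (m + k - Poly_Mapping.single v 1) (of_nat (Poly_Mapping.lookup k v) * (c * d))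
      = Poly_Mapping.single m c * pdiff v (Poly_Mapping.single k d)" for m k and c d :: 'b
    by (cases "Poly_Mapping.lookup k v = 0")
       (auto simp only: sub pdiff_single mult_single mult.left_commute mult_zero_left mult_zero_right
          single_zero of_nat_0)
  have ss: "pdiff v (Poly_Mapping.single m c * Poly_Mapping.single k d) =
      Poly_Mapping.single m c * pdiff v (Poly_Mapping.single k d) +
      Poly_Mapping.single k d * pdiff v (Poly_Mapping.single m c)" for m k and c d :: 'b
    unfolding mono[symmetric] add.commute[of k m] mult.commute[of d c]
    by (simp only: mult_single pdiff_single lookup_add of_nat_add distrib_right single_add add.commute)
  have "pdiff v (F * G) = F * pdiff v G + G * pdiff v F" for F G :: "('a, 'b) mpoly"
  proof (induction F rule: mpoly_induct_monomials)
    case (1 m c)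
    show ?case
      by (induction G rule: mpoly_induct_monomials)
         (simp_all add: ss distrib_left distrib_right pdiff_add)
  qed (simp add: distrib_left distrib_right pdiff_add)
  then show ?thesis unfolding derivation_def by (auto simp: pdiff_add pdiff_single)
qed

lemma pdiff_mult: "pdiff v (F * G) = F * pdiff v G + G * pdiff v F"
  using derivation_pdiff unfolding derivation_def by blast

lemma pdiff_Var: "pdiff v (Var w) = (if v = w then 1 else 0)"
  by (auto simp: pdiff_single lookup_single)

lemma derivation_zero: "derivation \<delta> \<Longrightarrow> \<delta> 0 = 0"
  unfolding derivation_def by (metis single_zero)

text \<open>
  Both sides are derivations and agree on the variables, which generate the algebra.
\<close>
lemma derivation_eq_sum_pdiff:
  assumes "derivation \<delta>"
  shows "\<delta> F = (\<Sum>v\<in>UNIV. \<delta> (Var v) * pdiff v F)"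
proof (induction F rule: mpoly_induct_algebra)
  case (Const c)
  have "pdiff v (Const c) = 0" for v :: 'a using derivation_pdiff unfolding derivation_def by blast
  then show ?case using assms unfolding derivation_def by simp
next
  case (Var v)
  have "(\<Sum>w\<in>UNIV. \<delta> (Var w) * pdiff w (Var v)) = (\<Sum>w\<in>UNIV. if w = v then \<delta> (Var v) else 0)"
    by (intro sum.cong) (auto simp: pdiff_Var)
  then show ?case by simp
next
  case (add F G)
  then show ?case using assms unfolding derivation_def
    by (simp add: pdiff_add distrib_left sum.distrib)
next
  case (mult F G)
  have "\<delta> (F * G) = F * \<delta> G + G * \<delta> F" using assms unfolding derivation_def by blast
  also have "\<dots> = (\<Sum>v\<in>UNIV. \<delta> (Var v) * (F * pdiff v G + G * pdiff v F))"
    unfolding mult.IH sum_distrib_left sum.distrib[symmetric]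
    by (intro sum.cong) (simp_all only: distrib_left mult.left_commute)
  also have "\<dots> = (\<Sum>v\<in>UNIV. \<delta> (Var v) * pdiff v (F * G))"
    by (simp only: pdiff_mult)
  finally show ?case .
qed

lemma derivation_diff: "derivation \<delta> \<Longrightarrow> \<delta> (F - G) = \<delta> F - \<delta> G"
  unfolding derivation_def by (metis add_diff_cancel_right' diff_add_cancel)

lemma derivation_mult: "derivation \<delta> \<Longrightarrow> \<delta> (F * G) = F * \<delta> G + G * \<delta> F"
  unfolding derivation_def by blast

lemma derivation_sum:
  "(\<And>v. v \<in> B \<Longrightarrow> derivation (\<delta> v)) \<Longrightarrow> derivation (\<lambda>F. \<Sum>v\<in>B. \<delta> v F)"
  unfolding derivation_def by (simp add: sum.distrib sum_distrib_left)

lemma pdiff_diff: "pdiff v (F - G) = pdiff v F - pdiff v G"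
  by (rule derivation_diff[OF derivation_pdiff])

section \<open>The Jacobian ideal without generators\<close>

text \<open>
  The ideal \<open>(J, I\<^sub>n(\<Theta>))\<close> in a form that refers neither to generators of \<open>J\<close> nor to coordinates.
\<close>
definition jac_ideal :: "nat \<Rightarrow> ('v::finite, 'k::comm_ring_1) mpoly set \<Rightarrow> ('v, 'k) mpoly set" where
  "jac_ideal n J = ideal.span (J \<union> {detf n (\<lambda>i j. \<delta> j (f i)) | f \<delta>.
     (\<forall>i<n. f i \<in> J) \<and> (\<forall>j<n. derivation (\<delta> j))})"

lemma jac_ideal_detI:
  "(\<And>i. i < n \<Longrightarrow> f i \<in> J) \<Longrightarrow> (\<And>j. j < n \<Longrightarrow> derivation (\<delta> j)) \<Longrightarrow>
   detf n (\<lambda>i j. \<delta> j (f i)) \<in> jac_ideal n J"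
  unfolding jac_ideal_def by (rule ideal.span_base) blast

text \<open>
  For \<open>f = \<Sum> a\<^sub>k g\<^sub>k\<close> one has \<open>\<delta> f = \<Sum> a\<^sub>k \<delta> g\<^sub>k + \<Sum> g\<^sub>k \<delta> a\<^sub>k\<close>, where the second sum is in \<open>J\<close>. So
  modulo \<open>J\<close> the rows of \<open>(\<delta>\<^sub>j f\<^sub>i)\<close> are combinations of rows that belong to generators, while its columns
  are combinations of columns of partial derivatives.
\<close>
lemma span_minors_eq_jac_ideal:
  fixes G :: "('v::finite, 'k::comm_ring_1) mpoly set"
  assumes G: "ideal.span G = J"
  shows "ideal.span (J \<union> minors_ideal n G UNIV jacobian) = jac_ideal n J" (is "?I = _")
proof
  have GJ: "G \<subseteq> J" using G ideal.span_superset by blast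
  have "minors n G UNIV jacobian \<subseteq> jac_ideal n J"
  proof
    fix x assume "x \<in> minors n G UNIV jacobian"
    then obtain \<rho> \<gamma> where "\<rho> ` {..<n} \<subseteq> G" "x = detf n (\<lambda>i j. jacobian (\<rho> i) (\<gamma> j))"
      unfolding minors_def detf_def by blast
    then show "x \<in> jac_ideal n J"
      using GJ unfolding jacobian_def
      by (auto intro!: jac_ideal_detI[where \<delta> = "\<lambda>j. pdiff (\<gamma> j)"] derivation_pdiff)
  qed
  then have "minors_ideal n G UNIV jacobian \<subseteq> jac_ideal n J"
    unfolding minors_ideal_def by (intro ideal.span_minimal) (auto simp: jac_ideal_def)
  moreover have "J \<subseteq> jac_ideal n J" by (auto simp: jac_ideal_def intro: ideal.span_base)
  ultimately show "?I \<subseteq> jac_ideal n J"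
    by (intro ideal.span_minimal) (auto simp: jac_ideal_def)
next
  have GJ: "G \<subseteq> J" using G ideal.span_superset by blast
  have subI: "ideal.subspace ?I" by simp
  have JI: "J \<subseteq> ?I" by (auto intro: ideal.span_base)
  have minor: "detf n (\<lambda>i j. pdiff (\<gamma> j) (f i)) \<in> ?I" if f: "\<And>i. i < n \<Longrightarrow> f i \<in> G" for f \<gamma>
  proof (cases "inj_on f {..<n} \<and> inj_on \<gamma> {..<n}")
    case True
    then have "detf n (\<lambda>i j. pdiff (\<gamma> j) (f i)) \<in> minors n G UNIV jacobian"
      using minors_memI[of f n G \<gamma> UNIV jacobian] f by (auto simp: jacobian_def)
    then show ?thesis unfolding minors_ideal_def by (auto intro!: ideal.span_base)
  next
    case False
    then consider i j where "i < n" "j < n" "i \<noteq> j" "f i = f j" | i j where "i < n" "j < n" "i \<noteq> j" "\<gamma> i = \<gamma> j"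
      by (auto simp: inj_on_def)
    then have "detf n (\<lambda>i j. pdiff (\<gamma> j) (f i)) = 0"
    proof cases
      case 1
      then show ?thesis by (intro detf_identical_rows[of i n j]) auto
    next
      case 2
      then show ?thesis
        by (subst detf_transpose[symmetric], intro detf_identical_rows[of i n j]) auto
    qed
    then show ?thesis using ideal.subspace_0[OF subI] by simp
  qed
  have columns: "detf n (\<lambda>i j. \<delta> j (f i)) \<in> ?I"
    if f: "\<And>i. i < n \<Longrightarrow> f i \<in> G" and \<delta>: "\<And>j. j < n \<Longrightarrow> derivation (\<delta> j)" for f \<delta>
  proof -
    have "detf n (\<lambda>j i. \<delta> j (f i)) \<in> ?I"
    proof (rule detf_rows_in_ideal[where S = "range (\<lambda>v i. pdiff v (f i))"
            and T = "{\<lambda>i. \<epsilon> (f i) | \<epsilon>. derivation \<epsilon>}"])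
      fix M :: "nat \<Rightarrow> nat \<Rightarrow> ('v, 'k) mpoly"
      assume "\<And>i. i < n \<Longrightarrow> M i \<in> range (\<lambda>v i. pdiff v (f i))"
      then have "\<forall>i\<in>{..<n}. \<exists>v. M i = (\<lambda>k. pdiff v (f k))" by blast
      then obtain \<gamma> where "\<And>i. i < n \<Longrightarrow> M i = (\<lambda>k. pdiff (\<gamma> i) (f k))"
        using bchoice[of "{..<n}"] by (metis lessThan_iff)
      then have "detf n M = detf n (\<lambda>j i. pdiff (\<gamma> j) (f i))" by (intro detf_cong) simp
      then show "detf n M \<in> ?I" using minor[where f = f and \<gamma> = \<gamma>, OF f] by (subst (asm) detf_transpose[symmetric]) simp
    next
      fix r c assume "r \<in> {\<lambda>i. \<epsilon> (f i) |\<epsilon>. derivation \<epsilon>}"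
        and s: "\<And>s. s \<in> range (\<lambda>v i. pdiff v (f i)) \<Longrightarrow> (\<Sum>j<n. s j * c j) \<in> ?I"
      then obtain \<epsilon> where \<epsilon>: "r = (\<lambda>i. \<epsilon> (f i))" "derivation \<epsilon>" by blast
      have "(\<Sum>j<n. r j * c j) = (\<Sum>j<n. \<Sum>v\<in>UNIV. \<epsilon> (Var v) * (pdiff v (f j) * c j))"
        unfolding \<epsilon>(1) derivation_eq_sum_pdiff[OF \<epsilon>(2), of "f _"]
        by (simp only: sum_distrib_right mult.assoc)
      also have "\<dots> = (\<Sum>v\<in>UNIV. \<epsilon> (Var v) * (\<Sum>j<n. pdiff v (f j) * c j))"
        by (subst sum.swap) (simp only: sum_distrib_left)
      also have "\<dots> \<in> ?I"
        by (intro ideal.subspace_sum[OF subI] ideal.subspace_scale[OF subI] s) blast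
      finally show "(\<Sum>j<n. r j * c j) \<in> ?I" .
    qed (use \<delta> in blast)
    then show ?thesis by (subst (asm) detf_transpose[symmetric])
  qed
  have "detf n (\<lambda>i j. \<delta> j (f i)) \<in> ?I"
    if f: "\<And>i. i < n \<Longrightarrow> f i \<in> J" and \<delta>: "\<And>j. j < n \<Longrightarrow> derivation (\<delta> j)" for f \<delta>
  proof (rule detf_rows_in_ideal[where S = "(\<lambda>g j. \<delta> j g) ` G" and T = "(\<lambda>g j. \<delta> j g) ` J"])
    fix M :: "nat \<Rightarrow> nat \<Rightarrow> ('v, 'k) mpoly"
    assume "\<And>i. i < n \<Longrightarrow> M i \<in> (\<lambda>g j. \<delta> j g) ` G"
    then have "\<forall>i\<in>{..<n}. \<exists>g. g \<in> G \<and> M i = (\<lambda>j. \<delta> j g)" by blast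
    then obtain g where g: "\<And>i. i < n \<Longrightarrow> g i \<in> G" "\<And>i. i < n \<Longrightarrow> M i = (\<lambda>j. \<delta> j (g i))"
      using bchoice[of "{..<n}"] by (metis lessThan_iff)
    then have "detf n M = detf n (\<lambda>i j. \<delta> j (g i))" by (intro detf_cong) simp
    then show "detf n M \<in> ?I" using columns[OF g(1) \<delta>] by simp
  next
    fix r c assume "r \<in> (\<lambda>g j. \<delta> j g) ` J"
      and s: "\<And>s. s \<in> (\<lambda>g j. \<delta> j g) ` G \<Longrightarrow> (\<Sum>j<n. s j * c j) \<in> ?I"
    then obtain g where g: "g \<in> J" "r = (\<lambda>j. \<delta> j g)" by blast
    have "g \<in> ideal.span G" using g G by simp
    then have "(\<Sum>j<n. \<delta> j g * c j) \<in> ?I"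
    proof (induction rule: ideal.span_induct_alt)
      case base
      have "(\<Sum>j<n. \<delta> j 0 * c j) = 0"
        by (intro sum.neutral) (simp add: \<delta> derivation_zero)
      then show ?case using ideal.subspace_0[OF subI] by simp
    next
      case (step a x y)
      have "(\<Sum>j<n. \<delta> j (a * x + y) * c j) =
          (\<Sum>j<n. a * (\<delta> j x * c j) + x * (\<delta> j a * c j) + \<delta> j y * c j)"
      proof (intro sum.cong refl)
        fix j assume "j \<in> {..<n}"
        then have "\<delta> j (a * x + y) = a * \<delta> j x + x * \<delta> j a + \<delta> j y"
          using \<delta> unfolding derivation_def by simp
        then show "\<delta> j (a * x + y) * c j = a * (\<delta> j x * c j) + x * (\<delta> j a * c j) + \<delta> j y * c j"
          by (simp only: distrib_right mult.assoc)
      qed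
      also have "\<dots> = a * (\<Sum>j<n. \<delta> j x * c j) + x * (\<Sum>j<n. \<delta> j a * c j) + (\<Sum>j<n. \<delta> j y * c j)"
        by (simp only: sum.distrib sum_distrib_left)
      also have "\<dots> \<in> ?I"
      proof (intro ideal.subspace_add[OF subI])
        show "a * (\<Sum>j<n. \<delta> j x * c j) \<in> ?I"
          by (rule ideal.subspace_scale[OF subI]) (use s[of "\<lambda>j. \<delta> j x"] step in blast)
        show "x * (\<Sum>j<n. \<delta> j a * c j) \<in> ?I"
          by (rule ideal_scale_right[OF subI]) (use step GJ JI in blast)
      qed (rule step)
      finally show ?case .
    qed
    then show "(\<Sum>j<n. r j * c j) \<in> ?I" unfolding g .
  qed (use f in blast)
  then have "{detf n (\<lambda>i j. \<delta> j (f i)) | f \<delta>. (\<forall>i<n. f i \<in> J) \<and> (\<forall>j<n. derivation (\<delta> j))} \<subseteq> ?I"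
    by blast
  then show "jac_ideal n J \<subseteq> ?I"
    unfolding jac_ideal_def[of n J] using JI by (intro ideal.span_minimal) auto
qed

text \<open>
  Conjugation by \<open>\<phi>\<close> turns a derivation \<open>\<delta>\<close> into the derivation \<open>\<phi> \<circ> \<delta> \<circ> \<psi>\<close>, and \<open>\<phi>\<close> commutes with
  determinants.
\<close>
lemma jac_ideal_image_subset:
  assumes \<phi>: "comm_ring_hom \<phi>" "\<And>c. \<phi> (Const c) = Const c"
    and \<psi>: "comm_ring_hom \<psi>" "\<And>c. \<psi> (Const c) = Const c"
    and inv: "\<And>F. \<phi> (\<psi> F) = F" "\<And>F. \<psi> (\<phi> F) = F"
  shows "\<phi> ` jac_ideal n J \<subseteq> jac_ideal n (\<phi> ` J)"
proof -
  interpret \<phi>: comm_ring_hom \<phi> by fact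
  interpret \<psi>: comm_ring_hom \<psi> by fact
  have "surj \<phi>" using inv(1) by (rule surjI)
  note span = image_ideal_span[OF \<phi>(1) this]
  have "\<phi> (detf n (\<lambda>i j. \<delta> j (f i))) \<in> jac_ideal n (\<phi> ` J)"
    if f: "\<forall>i<n. f i \<in> J" and \<delta>: "\<forall>j<n. derivation (\<delta> j)" for f \<delta>
  proof -
    have "\<phi> (detf n (\<lambda>i j. \<delta> j (f i))) = detf n (\<lambda>i j. \<phi> (\<delta> j (\<psi> (\<phi> (f i)))))"
      unfolding detf_def \<phi>.hom_det[symmetric] inv by (rule arg_cong[of _ _ det]) auto
    also have "\<dots> \<in> jac_ideal n (\<phi> ` J)"
    proof (rule jac_ideal_detI[where \<delta> = "\<lambda>j F. \<phi> (\<delta> j (\<psi> F))" and f = "\<lambda>i. \<phi> (f i)"])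
      show "derivation (\<lambda>F. \<phi> (\<delta> j (\<psi> F)))" if "j < n" for j
        using \<delta> that unfolding derivation_def
        by (simp add: \<phi>.hom_add \<phi>.hom_mult \<psi>.hom_add \<psi>.hom_mult inv \<psi>(2))
    qed (use f in blast)
    finally show ?thesis .
  qed
  then show ?thesis
    unfolding jac_ideal_def[of n J] span
    by (intro ideal.span_minimal) (auto simp: jac_ideal_def intro: ideal.span_base)
qed

lemma jac_ideal_image:
  assumes \<phi>: "comm_ring_hom \<phi>" "\<And>c. \<phi> (Const c) = Const c"
    and \<psi>: "comm_ring_hom \<psi>" "\<And>c. \<psi> (Const c) = Const c"
    and inv: "\<And>F. \<phi> (\<psi> F) = F" "\<And>F. \<psi> (\<phi> F) = F"
  shows "\<phi> ` jac_ideal n J = jac_ideal n (\<phi> ` J)"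
proof
  show "\<phi> ` jac_ideal n J \<subseteq> jac_ideal n (\<phi> ` J)" by (rule jac_ideal_image_subset[OF assms])
  have "\<psi> ` jac_ideal n (\<phi> ` J) \<subseteq> jac_ideal n (\<psi> ` \<phi> ` J)"
    by (rule jac_ideal_image_subset[OF \<psi> \<phi> inv(2,1)])
  then have "\<psi> ` jac_ideal n (\<phi> ` J) \<subseteq> jac_ideal n J" by (simp add: image_image inv)
  then have "\<phi> ` \<psi> ` jac_ideal n (\<phi> ` J) \<subseteq> \<phi> ` jac_ideal n J" by (rule image_mono)
  then show "jac_ideal n (\<phi> ` J) \<subseteq> \<phi> ` jac_ideal n J" by (simp add: image_image inv)
qed

section \<open>Vanishing ideals\<close>

text \<open>
  Over a finite field the polynomial \<open>1 + \<Prod> (X - a)\<close> has no root.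
\<close>
lemma infinite_UNIV_alg_closed: "infinite (UNIV :: 'k::alg_closed_field set)"
proof
  assume fin: "finite (UNIV :: 'k set)"
  define q where "q = (\<Prod>a\<in>(UNIV :: 'k set). [:-a, 1:])"
  have "degree q = card (UNIV :: 'k set)"
    unfolding q_def by (subst degree_prod_eq_sum_degree) auto
  then have deg: "degree q > 0" using fin by (simp add: card_gt_0_iff)
  then have "degree (q + 1) = degree q" by (intro degree_add_eq_left) simp
  then obtain x where "poly (q + 1) x = 0"
    using alg_closed_imp_poly_has_root[of "q + 1"] deg by auto
  moreover have "poly q x = 0"
    unfolding q_def poly_prod by (rule prod_zero) (use fin in auto)
  ultimately show False by simp
qed

lemma coeffs_zero_if_poly_function_zero:
  fixes c :: "nat \<Rightarrow> 'k::field"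
  assumes inf: "infinite (UNIV :: 'k set)" and D: "finite D"
    and zero: "\<And>t. (\<Sum>d\<in>D. c d * t ^ d) = 0" and d: "d \<in> D"
  shows "c d = 0"
proof -
  define q where "q = (\<Sum>d\<in>D. Polynomial.monom (c d) d)"
  have "poly q t = 0" for t unfolding q_def poly_sum poly_monom by (rule zero)
  then have "q = 0" using poly_roots_finite[of q] inf by auto
  then have "coeff q d = 0" by simp
  then show ?thesis using D d by (simp add: q_def coeff_sum)
qed

definition vanishing_ideal :: "('k::field ^ 'v::finite) set \<Rightarrow> ('v, 'k) mpoly set" where
  "vanishing_ideal A = {F. \<forall>a\<in>A. eval_mpoly F a = 0}"

lemma subspace_vanishing_ideal [simp]: "ideal.subspace (vanishing_ideal A)"
  by (rule ideal.subspaceI) (auto simp: vanishing_ideal_def)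

definition mdeg :: "('v::finite \<Rightarrow>\<^sub>0 nat) \<Rightarrow> nat" where
  "mdeg m = (\<Sum>v\<in>UNIV. Poly_Mapping.lookup m v)"

lemma eval_single_scale:
  "eval_mpoly (Poly_Mapping.single m c) (t *s a) = eval_mpoly (Poly_Mapping.single m c) a * t ^ mdeg m"
  by (simp only: eval_single mdeg_def vector_smult_component power_mult_distrib prod.distrib power_sum
      mult.assoc mult.commute mult.left_commute)

lemma eval_sum_monomials:
  "eval_mpoly F a = (\<Sum>m\<in>Poly_Mapping.keys F. eval_mpoly (Poly_Mapping.single m (Poly_Mapping.lookup F m)) a)"
  by (subst poly_mapping_sum_single[of F]) (rule eval_sum)

text \<open>
  Restricted to the line through \<open>a\<close>, the values of \<open>F\<close> form a polynomial in \<open>t\<close> whose coefficients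
  are the values at \<open>a\<close> of the homogeneous components of \<open>F\<close>. Over an infinite field it is zero only if all
  its coefficients are.
\<close>
lemma homogeneous_components_vanish:
  fixes F :: "('v::finite, 'k::field) mpoly"
  assumes inf: "infinite (UNIV :: 'k set)" and zero: "\<And>t. eval_mpoly F (t *s a) = 0"
  shows "(\<Sum>m | m \<in> Poly_Mapping.keys F \<and> mdeg m = d.
    eval_mpoly (Poly_Mapping.single m (Poly_Mapping.lookup F m)) a) = 0" (is "?c d = 0")
proof (cases "d \<in> mdeg ` Poly_Mapping.keys F")
  case True
  show ?thesis
  proof (rule coeffs_zero_if_poly_function_zero[OF inf _ _ True, of ?c])
    fix t
    have "eval_mpoly F (t *s a) =
        (\<Sum>m\<in>Poly_Mapping.keys F. eval_mpoly (Poly_Mapping.single m (Poly_Mapping.lookup F m)) a * t ^ mdeg m)"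
      by (subst eval_sum_monomials) (simp only: eval_single_scale)
    also have "\<dots> = (\<Sum>d\<in>mdeg ` Poly_Mapping.keys F. \<Sum>m | m \<in> Poly_Mapping.keys F \<and> mdeg m = d.
        eval_mpoly (Poly_Mapping.single m (Poly_Mapping.lookup F m)) a * t ^ mdeg m)"
      by (rule sum.image_gen) simp
    also have "\<dots> = (\<Sum>d\<in>mdeg ` Poly_Mapping.keys F. ?c d * t ^ d)"
      by (simp add: sum_distrib_right)
    finally show "(\<Sum>d\<in>mdeg ` Poly_Mapping.keys F. ?c d * t ^ d) = 0" using zero by simp
  qed simp
next
  case False
  then have "{m. m \<in> Poly_Mapping.keys F \<and> mdeg m = d} = {}" by auto
  then show ?thesis by (simp only: sum.empty)
qed

lemma point_ideal_eq_vanishing_ideal: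
  fixes p :: "('k::field ^ 'v::finite) set"
  assumes inf: "infinite (UNIV :: 'k set)" and p: "vec.subspace p"
  shows "point_ideal p = vanishing_ideal p"
proof
  show "point_ideal p \<subseteq> vanishing_ideal p"
    unfolding point_ideal_def
    by (rule ideal.span_minimal[OF _ subspace_vanishing_ideal]) (auto simp: vanishing_ideal_def)
  show "vanishing_ideal p \<subseteq> point_ideal p"
  proof
    fix F assume F: "F \<in> vanishing_ideal p"
    define H where "H d = (\<Sum>m | m \<in> Poly_Mapping.keys F \<and> mdeg m = d.
      Poly_Mapping.single m (Poly_Mapping.lookup F m))" for d
    have "H d \<in> point_ideal p" for d
      unfolding point_ideal_def
    proof (rule ideal.span_base, intro CollectI conjI ballI exI)
      have "Poly_Mapping.keys (H d) \<subseteq> {m. m \<in> Poly_Mapping.keys F \<and> mdeg m = d}"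
        unfolding H_def by (rule order_trans[OF keys_sum]) (auto split: if_splits)
      then show "homogeneous d (H d)" unfolding homogeneous_def mdeg_def by auto
      show "eval_mpoly (H d) a = 0" if "a \<in> p" for a
        unfolding H_def eval_sum
        by (rule homogeneous_components_vanish[OF inf])
           (use F that p in \<open>auto simp: vanishing_ideal_def vec.subspace_scale\<close>)
    qed
    then have "(\<Sum>d\<in>mdeg ` Poly_Mapping.keys F. H d) \<in> point_ideal p"
      unfolding point_ideal_def by (rule ideal.span_sum)
    moreover have "(\<Sum>d\<in>mdeg ` Poly_Mapping.keys F. H d) =
        (\<Sum>m\<in>Poly_Mapping.keys F. Poly_Mapping.single m (Poly_Mapping.lookup F m))"
      unfolding H_def by (rule sum.image_gen[symmetric]) simp
    ultimately show "F \<in> point_ideal p" by (simp only: poly_mapping_sum_single[symmetric])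
  qed
qed

lemma defining_ideal_eq_vanishing_ideal:
  fixes \<Gamma> :: "('k::field ^ 'v::finite) set set"
  assumes inf: "infinite (UNIV :: 'k set)" and "\<And>p. p \<in> \<Gamma> \<Longrightarrow> vec.subspace p"
  shows "defining_ideal \<Gamma> = vanishing_ideal (\<Union>\<Gamma>)"
  unfolding defining_ideal_def
  using assms by (auto simp: point_ideal_eq_vanishing_ideal vanishing_ideal_def)

lemma lin_subst_vanishing_ideal:
  assumes "A ** B = Finite_Cartesian_Product.mat 1" "B ** A = Finite_Cartesian_Product.mat 1"
  shows "vanishing_ideal ((*v) A ` C) = lin_subst B ` vanishing_ideal C"
proof -
  have inv: "lin_subst B (lin_subst A F) = F" "lin_subst A (lin_subst B F) = F" for F
    by (simp_all add: lin_subst_compose assms lin_subst_id)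
  have "F \<in> vanishing_ideal ((*v) A ` C) \<longleftrightarrow> lin_subst A F \<in> vanishing_ideal C" for F
    by (auto simp: vanishing_ideal_def eval_lin_subst)
  moreover have "lin_subst A F \<in> vanishing_ideal C \<longleftrightarrow> F \<in> lin_subst B ` vanishing_ideal C" for F
    by (auto simp: inv intro: image_eqI[of F _ "lin_subst A F"])
  ultimately show ?thesis by blast
qed

section \<open>Points in hyperplane linear position in coordinates\<close>

text \<open>
  The affine cone over the vertices of the coordinate simplex and the point whose coordinates are \<open>1\<close>
  apart from the coordinate \<open>z\<close>, which is \<open>0\<close>.
\<close>
definition frame_cone :: "'v \<Rightarrow> ('k::field ^ 'v::finite) set" where
  "frame_cone z = {t *s axis v 1 | t v. True} \<union> {t *s (\<chi> v. if v = z then 0 else 1) | t. True}"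

lemma subspace_dim_1_obtains:
  fixes q :: "('k::field ^ 'v::finite) set"
  assumes "vec.subspace q" "vec.dim q = 1"
  obtains x where "q = vec.span {x}"
proof -
  obtain B where B: "B \<subseteq> q" "vec.independent B" "q \<subseteq> vec.span B" "card B = vec.dim q"
    using vec.basis_exists by blast
  then obtain x where "B = {x}" using assms(2) by (metis card_1_singletonE)
  then have "q = vec.span {x}" using B assms(1) by (metis vec.span_minimal subset_antisym)
  then show ?thesis by (rule that)
qed

lemma hyperplane_of_extends:
  fixes U W :: "('k::field ^ 'v::finite) set"
  assumes "U \<subseteq> W" "vec.subspace W" "vec.dim U < vec.dim W"
  obtains H where "hyperplane_of W H" "U \<subseteq> H"
proof -
  obtain B where B: "B \<subseteq> U" "vec.independent B" "U \<subseteq> vec.span B" "card B = vec.dim U"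
    using vec.basis_exists by blast
  obtain C where C: "B \<subseteq> C" "C \<subseteq> W" "vec.independent C" "W \<subseteq> vec.span C"
    using vec.maximal_independent_subset_extend[of B W] B assms(1) by blast
  have fin: "finite C" using C(3) by (rule vec.finiteI_independent)
  have cardC: "card C = vec.dim W" using vec.basis_card_eq_dim[OF C(2,4,3)] .
  then have "B \<noteq> C" using B(4) assms(3) by auto
  then obtain c where c: "c \<in> C" "c \<notin> B" using C(1) by blast
  have "vec.dim (vec.span (C - {c})) = card (C - {c})"
    using C(3) by (intro vec.dim_span_eq_card_independent vec.independent_mono[OF C(3)]) auto
  moreover have "card (C - {c}) + 1 = card C" using card.remove[OF fin c(1)] by simp
  moreover have "vec.span (C - {c}) \<subseteq> W"
    using C(2) assms(2) by (intro vec.span_minimal) auto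
  ultimately have "hyperplane_of W (vec.span (C - {c}))"
    unfolding hyperplane_of_def using cardC by simp
  moreover have "U \<subseteq> vec.span (C - {c})"
    using order_trans[OF B(3) vec.span_mono[of B "C - {c}"]] C(1) c(2) by blast
  ultimately show ?thesis by (rule that)
qed

lemma span_Union_lines:
  "(\<And>q. q \<in> T \<Longrightarrow> q = vec.span {g q}) \<Longrightarrow> vec.span (\<Union>T) = vec.span (g ` T :: ('k::field ^ 'v::finite) set)"
proof
  assume q: "\<And>q. q \<in> T \<Longrightarrow> q = vec.span {g q}"
  have "g q \<in> \<Union>T" if "q \<in> T" for q
  proof (rule UnionI[OF that])
    show "g q \<in> q" by (subst q[OF that]) (rule vec.span_base, simp)
  qed
  then show "vec.span (g ` T) \<subseteq> vec.span (\<Union>T)" by (intro vec.span_mono) auto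
  have "q \<subseteq> vec.span (g ` T)" if "q \<in> T" for q
    by (subst q[OF that]) (rule vec.span_mono, use that in blast)
  then show "vec.span (\<Union>T) \<subseteq> vec.span (g ` T)" by (intro vec.span_minimal) auto
qed

lemma columns_apply:
  "(\<chi> i v. \<beta> v $ i) *v x = (\<Sum>v\<in>UNIV. x $ v *s \<beta> v :: 'k::field ^ 'v::finite)"
  by (simp add: matrix_mult_sum column_def)

text \<open>
  General position says that any \<open>n\<close> of the \<open>n + 1\<close> points on \<open>H\<close> are given by a basis of \<open>H\<close>. Expressed
  in the basis of the first \<open>n\<close> points, the last one therefore has no zero coordinate, and the basis can be
  rescaled so that all these coordinates become \<open>1\<close>. A vector of the point off \<open>H\<close> completes the basis.
\<close>
lemma hyperplane_linear_position_obtains_frame: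
  fixes \<Gamma> :: "('k::field ^ 'v::finite) set set"
  assumes n: "CARD('v) = n + 1" "n \<ge> 1" and card\<Gamma>: "card \<Gamma> = n + 2" and pos: "hyperplane_linear_position \<Gamma>"
  obtains A :: "'k ^ 'v ^ 'v" and z where "invertible A" "\<Union>\<Gamma> = (*v) A ` frame_cone z"
proof -
  obtain p H where fin: "finite \<Gamma>" and pts: "\<Gamma> \<subseteq> points_of UNIV" and p: "p \<in> \<Gamma>"
    and H: "hyperplane_of UNIV H" "vec.span (\<Union>(\<Gamma> - {p})) = H"
    and glp: "general_linear_position H (\<Gamma> - {p})" and pH: "\<not> p \<subseteq> H"
    using pos unfolding hyperplane_linear_position_def by blast
  have subH: "vec.subspace H" and dimH: "vec.dim H = n"
    using H(1) vec_dim_card[where 'a = 'k and 'n = 'v] n unfolding hyperplane_of_def by auto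
  have card': "card (\<Gamma> - {p}) = n + 1" using card\<Gamma> p fin by simp
  have "\<forall>q\<in>\<Gamma>. \<exists>x. q = vec.span {x}"
    using pts subspace_dim_1_obtains unfolding points_of_def by blast
  then obtain g where g: "\<And>q. q \<in> \<Gamma> \<Longrightarrow> q = vec.span {g q}" by metis
  have ind: "vec.independent (g ` T) \<and> inj_on g T" if T: "T \<subseteq> \<Gamma> - {p}" "card T = n" for T
  proof -
    have finT: "finite T" using T(1) fin finite_subset by blast
    have TH: "\<Union>T \<subseteq> H" using T(1) H(2) vec.span_superset[of "\<Union>(\<Gamma> - {p})"] by blast
    have "\<not> (\<exists>K. hyperplane_of H K \<and> \<Union>T \<subseteq> K)"
      using glp T dimH card' n unfolding general_linear_position_def Let_def by auto
    then have "\<not> vec.dim (\<Union>T) < vec.dim H"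
      by (meson hyperplane_of_extends[OF TH subH])
    moreover have "vec.dim (\<Union>T) = vec.dim (g ` T)"
      using span_Union_lines[of T g] g T(1) by (metis (no_types, lifting) DiffE subsetD vec.dim_span)
    ultimately have dim: "vec.dim (g ` T) \<ge> n" using dimH by simp
    moreover have "vec.dim (g ` T) \<le> card (g ` T)"
      by (rule vec.dim_le_card[OF vec.span_superset finite_imageI[OF finT]])
    moreover have "card (g ` T) \<le> card T" using finT by (rule card_image_le)
    ultimately have "card (g ` T) = card T" "vec.dim (g ` T) \<ge> card (g ` T)" using T(2) by auto
    then show ?thesis
      using vec.card_le_dim_spanning[OF subset_refl vec.span_superset finite_imageI[OF finT]]
        eq_card_imp_inj_on[OF finT] by blast
  qed
  obtain q0 where q0: "q0 \<in> \<Gamma> - {p}" using card' by (metis card.empty ex_in_conv add_is_0 one_neq_zero)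
  define T where "T = \<Gamma> - {p} - {q0}"
  have finT: "finite T" and cardT: "card T = n" and T\<Gamma>: "T \<subseteq> \<Gamma> - {p}"
    using card' q0 fin by (auto simp: T_def)
  have indT: "vec.independent (g ` T)" and injT: "inj_on g T" using ind[OF T\<Gamma> cardT] by auto
  have gq: "g q \<in> q" if "q \<in> \<Gamma>" for q
    by (subst g[OF that]) (rule vec.span_base, simp)
  have gH: "g q \<in> H" if "q \<in> \<Gamma> - {p}" for q
    unfolding H(2)[symmetric] by (rule vec.span_base) (use gq[of q] that in blast)
  have spanT: "H \<subseteq> vec.span (g ` T)"
    using vec.card_eq_dim[of "g ` T" H] indT gH T\<Gamma> finT card_image[OF injT] cardT dimH by auto
  obtain c where c: "g q0 = (\<Sum>q\<in>T. c q *s g q)"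
  proof -
    obtain u where "g q0 = (\<Sum>x\<in>g ` T. u x *s x)"
      using spanT gH[OF q0] vec.span_finite[of "g ` T"] finT by auto
    then have "g q0 = (\<Sum>q\<in>T. u (g q) *s g q)" by (simp add: sum.reindex[OF injT])
    then show ?thesis by (rule that)
  qed
  have c_nonzero: "c q \<noteq> 0" if q: "q \<in> T" for q
  proof
    \<comment> \<open>Otherwise the last point would depend on the n - 1 points other than q.\<close>
    assume "c q = 0"
    then have "g q0 = (\<Sum>r\<in>T - {q}. c r *s g r)"
      unfolding c using finT q by (simp add: sum.remove)
    also have "\<dots> \<in> vec.span (g ` (T - {q}))"
      by (intro vec.span_sum vec.span_scale vec.span_base) auto
    finally have 1: "g q0 \<in> vec.span (g ` (T - {q}))" .
    let ?T = "insert q0 (T - {q})"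
    have "q0 \<notin> T" by (simp add: T_def)
    have "card (T - {q}) + 1 = n" using card.remove[OF finT q] cardT by simp
    moreover have "card ?T = card (T - {q}) + 1" using finT \<open>q0 \<notin> T\<close> by simp
    ultimately have "card ?T = n" by simp
    moreover have "?T \<subseteq> \<Gamma> - {p}" using T\<Gamma> q0 by blast
    ultimately have 2: "vec.independent (g ` ?T)" "inj_on g ?T" using ind by blast+
    have "g q0 \<notin> vec.span (g ` ?T - {g q0})"
      using 2(1) unfolding vec.dependent_def by blast
    moreover have "g ` (T - {q}) \<subseteq> g ` ?T - {g q0}"
      using \<open>q0 \<notin> T\<close> 2(2) unfolding inj_on_def by blast
    ultimately show False using 1 vec.span_mono by blast
  qed
  have "card (insert p T) = CARD('v)" using finT cardT T\<Gamma> n by (subst card_insert_disjoint) auto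
  then obtain f where f: "bij_betw f (UNIV :: 'v set) (insert p T)"
    using finT finite_same_card_bij[of "UNIV :: 'v set" "insert p T"] by auto
  then obtain z where z: "f z = p" by (metis bij_betw_def image_iff insertI1)
  have fT: "bij_betw f (UNIV - {z}) T"
  proof -
    have "inj f" "range f = insert p T" using f by (auto simp: bij_betw_def)
    moreover have "p \<notin> T" using T\<Gamma> by blast
    ultimately show ?thesis
      using z image_set_diff[of f UNIV "{z}"] by (simp add: bij_betw_def inj_on_subset[of f UNIV])
  qed
  define \<beta> where "\<beta> v = (if v = z then g p else c (f v) *s g (f v))" for v
  define A :: "'k ^ 'v ^ 'v" where "A = (\<chi> i v. \<beta> v $ i)"
  have A: "A *v x = (\<Sum>v\<in>UNIV. x $ v *s \<beta> v)" for x unfolding A_def by (rule columns_apply)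
  have span\<beta>: "vec.span {\<beta> v} = f v" for v
  proof (cases "v = z")
    case True
    then show ?thesis using g[OF p] z by (simp add: \<beta>_def)
  next
    case False
    then have "f v \<in> T" using fT by (auto simp: bij_betw_def)
    then have "c (f v) \<noteq> 0" "f v = vec.span {g (f v)}" using c_nonzero g T\<Gamma> by auto
    moreover have "vec.span {c (f v) *s g (f v)} = vec.span {g (f v)}"
      using vec.span_image_scale[of "{g (f v)}" "\<lambda>_. c (f v)"] \<open>c (f v) \<noteq> 0\<close> by simp
    ultimately show ?thesis using False by (simp add: \<beta>_def)
  qed
  have gp: "g p \<notin> H" using g[OF p] pH subH by (metis empty_subsetI insert_subset vec.span_minimal)
  have "invertible A"
  proof -
    have col: "columns A = range \<beta>" by (auto simp: columns_def column_def A_def)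
    have gin: "g q \<in> vec.span (range \<beta>)" if q: "q \<in> insert p T" for q
    proof -
      have "q \<in> range f" using f q unfolding bij_betw_def by blast
      then obtain v where "q = f v" by blast
      then have "g q \<in> vec.span {\<beta> v}" unfolding span\<beta> using gq[of q] q p T\<Gamma> by blast
      then show ?thesis using vec.span_mono[of "{\<beta> v}" "range \<beta>"] by auto
    qed
    then have "insert (g p) H \<subseteq> vec.span (range \<beta>)"
      using order_trans[OF spanT vec.span_minimal[of "g ` T" "vec.span (range \<beta>)"]] by auto
    then have "vec.dim (insert (g p) H) \<le> vec.dim (vec.span (range \<beta>))" by (rule vec.dim_subset)
    moreover have "vec.dim (insert (g p) H) = n + 1"
      using gp subH dimH by (simp add: vec.dim_insert vec.span_eq_iff[THEN iffD2])
    ultimately have "vec.dim (vec.span (range \<beta>)) = CARD('v)"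
      using n vec.dim_subset[of "vec.span (range \<beta>)" UNIV] vec_dim_card[where 'a = 'k and 'n = 'v] by simp
    then have "vec.span (range \<beta>) = UNIV"
      using vec.subspace_dim_equal[of "vec.span (range \<beta>)" UNIV] vec_dim_card[where 'a = 'k and 'n = 'v] by simp
    then show ?thesis using matrix_right_invertible_span_columns[of A] col invertible_right_inverse by metis
  qed
  moreover have "\<Union>\<Gamma> = (*v) A ` frame_cone z"
  proof -
    have axis: "A *v (t *s axis v 1) = t *s \<beta> v" for t v
    proof -
      have "A *v (t *s axis v 1) = (\<Sum>w\<in>UNIV. if w = v then t *s \<beta> v else 0)"
        unfolding A by (intro sum.cong) (auto simp: axis_def)
      then show ?thesis by simp
    qed
    have unit: "A *v (t *s (\<chi> v. if v = z then 0 else 1)) = t *s g q0" for t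
    proof -
      have "A *v (t *s (\<chi> v. if v = z then 0 else 1)) = (\<Sum>v\<in>UNIV - {z}. t *s \<beta> v)"
        unfolding A by (rule sum.mono_neutral_cong_right) auto
      also have "\<dots> = (\<Sum>v\<in>UNIV - {z}. t *s (c (f v) *s g (f v)))"
        by (intro sum.cong) (auto simp: \<beta>_def)
      also have "\<dots> = (\<Sum>q\<in>T. t *s (c q *s g q))"
        using fT by (rule sum.reindex_bij_betw)
      also have "\<dots> = t *s g q0" unfolding c by (rule vec.scale_sum_right[symmetric])
      finally show ?thesis .
    qed
    have "\<Gamma> = insert q0 (range f)" using f q0 p by (auto simp: bij_betw_def T_def)
    then have "\<Union>\<Gamma> = vec.span {g q0} \<union> (\<Union>v. vec.span {\<beta> v})" using g[of q0] q0 by (auto simp: span\<beta>)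
    also have "\<dots> = {t *s \<beta> v | t v. True} \<union> {t *s g q0 | t. True}"
      unfolding vec.span_singleton by auto
    also have "\<dots> = (*v) A ` frame_cone z"
      unfolding frame_cone_def image_Un
      by (intro arg_cong2[of _ _ _ _ "(\<union>)"]) (force simp: axis unit)+
    finally show ?thesis .
  qed
  ultimately show ?thesis by (rule that)
qed

section \<open>Weight filtrations\<close>

definition wt :: "('v::finite \<Rightarrow> nat) \<Rightarrow> ('v \<Rightarrow>\<^sub>0 nat) \<Rightarrow> nat" where
  "wt w m = (\<Sum>v\<in>UNIV. w v * Poly_Mapping.lookup m v)"

definition filt :: "('v::finite \<Rightarrow> nat) \<Rightarrow> nat \<Rightarrow> ('v, 'k::comm_ring_1) mpoly set" where
  "filt w d = {F. \<forall>m\<in>Poly_Mapping.keys F. d \<le> wt w m}"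

lemma wt_add: "wt w (m + m') = wt w m + wt w m'"
  by (simp add: wt_def lookup_add distrib_left sum.distrib)

lemma wt_single [simp]: "wt w (Poly_Mapping.single v k) = w v * k"
proof -
  have "wt w (Poly_Mapping.single v k) = (\<Sum>u\<in>UNIV. if u = v then w v * k else 0)"
    unfolding wt_def by (intro sum.cong) (auto simp: lookup_single)
  then show ?thesis by simp
qed

lemma mdeg_add: "mdeg (m + m') = mdeg m + mdeg m'"
  by (simp add: mdeg_def lookup_add sum.distrib)

lemma mdeg_single [simp]: "mdeg (Poly_Mapping.single v k) = k"
  using wt_single[of "\<lambda>_. 1" v k] by (simp add: mdeg_def wt_def)

lemma single_in_filt: "d \<le> wt w m \<Longrightarrow> Poly_Mapping.single m c \<in> filt w d"
  by (simp add: filt_def)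

lemma filt_0: "filt w 0 = UNIV"
  by (simp add: filt_def)

lemma filt_antimono: "d \<le> d' \<Longrightarrow> filt w d' \<subseteq> filt w d"
  by (auto simp: filt_def)

lemma filt_mult:
  assumes "F \<in> filt w a" "G \<in> filt w b"
  shows "F * G \<in> filt w (a + b)"
  unfolding filt_def
proof (intro CollectI ballI)
  fix m assume "m \<in> Poly_Mapping.keys (F * G)"
  then obtain k l where "m = k + l" "k \<in> Poly_Mapping.keys F" "l \<in> Poly_Mapping.keys G"
    using keys_mult[of F G] by blast
  then show "a + b \<le> wt w m" using assms by (auto simp: filt_def wt_add intro: add_mono)
qed

lemma subspace_filt [simp]: "ideal.subspace (filt w d)"
proof (rule ideal.subspaceI)
  show "F + G \<in> filt w d" if "F \<in> filt w d" "G \<in> filt w d" for F G :: "('a, 'b) mpoly"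
    using that keys_add[of F G] unfolding filt_def by blast
  show "c * F \<in> filt w d" if "F \<in> filt w d" for c F :: "('a, 'b) mpoly"
    using filt_mult[of c w 0 F d] that by (simp add: filt_0)
qed (simp add: filt_def)

lemma filt_prod:
  assumes "finite A" and "\<And>i. i \<in> A \<Longrightarrow> f i \<in> filt w (d i)"
  shows "prod f A \<in> filt w (sum d A)"
  using assms by (induction A rule: finite_induct) (auto simp: filt_0 filt_mult)

lemma filt_pdiff:
  assumes "F \<in> filt w d"
  shows "pdiff v F \<in> filt w (d - w v)"
  unfolding pdiff_def
proof (rule ideal.subspace_sum[OF subspace_filt])
  fix m assume m: "m \<in> Poly_Mapping.keys F"
  show "Poly_Mapping.single (m - Poly_Mapping.single v 1)
      (of_nat (Poly_Mapping.lookup m v) * Poly_Mapping.lookup F m) \<in> filt w (d - w v)"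
  proof (cases "Poly_Mapping.lookup m v = 0")
    case True
    then show ?thesis using ideal.subspace_0[OF subspace_filt] by simp
  next
    case False
    then have "m = (m - Poly_Mapping.single v 1) + Poly_Mapping.single v 1"
      by (intro poly_mapping_eqI) (auto simp: lookup_add lookup_minus lookup_single when_def)
    then have "wt w m = wt w (m - Poly_Mapping.single v 1) + w v" by (metis wt_add wt_single mult_1_right)
    then show ?thesis using assms m by (intro single_in_filt) (auto simp: filt_def)
  qed
qed

lemma filt_detf:
  assumes "\<And>i j. i < n \<Longrightarrow> j < n \<Longrightarrow> M i j \<in> filt w (b j)"
  shows "detf n M \<in> filt w (\<Sum>j<n. b j)"
proof -
  have "detf n M = (\<Sum>p | p permutes {0..<n}. signof p * (\<Prod>i = 0..<n. M i (p i)))"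
    unfolding detf_def
    by (subst det_def'[of _ n], simp, intro sum.cong refl arg_cong2[of _ _ _ _ "(*)"] prod.cong)
       (auto simp: permutes_in_image)
  also have "\<dots> \<in> filt w (\<Sum>j<n. b j)"
  proof (intro ideal.subspace_sum[OF subspace_filt] ideal.subspace_scale[OF subspace_filt])
    fix p assume "p \<in> {p. p permutes {0..<n}}"
    then have p: "p permutes {0..<n}" by simp
    have "(\<Prod>i = 0..<n. M i (p i)) \<in> filt w (\<Sum>i = 0..<n. b (p i))"
      using assms permutes_in_image[OF p] by (intro filt_prod) auto
    also have "(\<Sum>i = 0..<n. b (p i)) = (\<Sum>j<n. b j)"
      using sum.permute[OF p, of b] by (simp add: comp_def atLeast0LessThan)
    finally show "(\<Prod>i = 0..<n. M i (p i)) \<in> filt w (\<Sum>j<n. b j)" .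
  qed
  finally show ?thesis .
qed

lemma ideal_mult_filt:
  assumes "x \<in> ideal_mult J (filt w a)" "y \<in> filt w b"
  shows "y * x \<in> ideal_mult J (filt w (a + b))"
proof -
  have "ideal_mult (filt w b) (filt w a) \<subseteq> filt w (a + b)"
    by (rule ideal_mult_least[OF subspace_filt]) (metis filt_mult add.commute)
  then show ?thesis
    using ideal_mult_left_commute[OF assms(2,1)] ideal_mult_mono by blast
qed

section \<open>The ideal of the frame\<close>

definition frame_ideal :: "'v \<Rightarrow> ('v::finite, 'k::field) mpoly set" where
  "frame_ideal z = vanishing_ideal (frame_cone z)"

abbreviation unit_point :: "'v \<Rightarrow> 'k::field ^ 'v::finite" where
  "unit_point z \<equiv> \<chi> v. if v = z then 0 else 1"

lemma frame_idealI:
  assumes "\<And>v t. eval_mpoly F (t *s axis v 1) = 0" "\<And>t. eval_mpoly F (t *s unit_point z) = 0"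
  shows "F \<in> frame_ideal z"
  using assms by (auto simp: frame_ideal_def vanishing_ideal_def frame_cone_def)

lemma frame_idealD:
  assumes "F \<in> frame_ideal z"
  shows "eval_mpoly F (t *s axis v 1) = 0" "eval_mpoly F (t *s unit_point z) = 0"
  using assms by (auto simp: frame_ideal_def vanishing_ideal_def frame_cone_def)

lemma subspace_frame_ideal [simp]: "ideal.subspace (frame_ideal z)"
  by (simp add: frame_ideal_def)

text \<open>
  The monomial \<open>1\<close> is \<open>pure v\<close> for every \<open>v\<close>. A mixed monomial vanishes at all vertices of the simplex,
  and it vanishes at \<open>u\<close> exactly if it involves \<open>z\<close>.
\<close>
definition pure :: "'v \<Rightarrow> ('v::finite \<Rightarrow>\<^sub>0 nat) \<Rightarrow> bool" where
  "pure v m \<longleftrightarrow> (\<forall>u. u \<noteq> v \<longrightarrow> Poly_Mapping.lookup m u = 0)"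

definition mixed :: "('v::finite \<Rightarrow>\<^sub>0 nat) \<Rightarrow> bool" where
  "mixed m \<longleftrightarrow> (\<forall>v. \<not> pure v m)"

lemma pure_eq_single: "pure v m \<Longrightarrow> m = Poly_Mapping.single v (mdeg m)"
proof -
  assume m: "pure v m"
  then have "m = Poly_Mapping.single v (Poly_Mapping.lookup m v)"
    by (intro poly_mapping_eqI) (auto simp: pure_def lookup_single when_def)
  then show ?thesis by (metis mdeg_single)
qed

lemma mixedI: "a \<noteq> b \<Longrightarrow> Poly_Mapping.lookup m a \<noteq> 0 \<Longrightarrow> Poly_Mapping.lookup m b \<noteq> 0 \<Longrightarrow> mixed m"
  unfolding mixed_def pure_def by metis

lemma mixedE:
  assumes "mixed m"
  obtains a b where "a \<noteq> b" "Poly_Mapping.lookup m a \<noteq> 0" "Poly_Mapping.lookup m b \<noteq> 0"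
  using assms unfolding mixed_def pure_def by metis

lemma eval_axis_single:
  fixes c :: "'k::field"
  shows "eval_mpoly (Poly_Mapping.single m c) (axis v 1) = (if pure v m then c else 0)"
proof (cases "pure v m")
  case True
  have "(\<Prod>u\<in>UNIV. (axis v 1 $ u) ^ Poly_Mapping.lookup m u) = (1 :: 'k)"
    by (intro prod.neutral) (use True in \<open>auto simp: pure_def axis_def\<close>)
  then show ?thesis using True by (simp add: eval_single)
next
  case False
  then obtain u where "u \<noteq> v" "Poly_Mapping.lookup m u \<noteq> 0" unfolding pure_def by blast
  then have "(\<Prod>u\<in>UNIV. (axis v 1 $ u) ^ Poly_Mapping.lookup m u) = (0 :: 'k)"
    by (intro prod_zero bexI[of _ u]) (auto simp: axis_def)
  then show ?thesis using False by (simp add: eval_single)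
qed

lemma eval_unit_single:
  fixes c :: "'k::field"
  shows "eval_mpoly (Poly_Mapping.single m c) (unit_point z) = (if Poly_Mapping.lookup m z = 0 then c else 0)"
proof (cases "Poly_Mapping.lookup m z = 0")
  case True
  have "(\<Prod>u\<in>UNIV. (unit_point z $ u) ^ Poly_Mapping.lookup m u) = (1 :: 'k)"
    by (intro prod.neutral) (use True in auto)
  then show ?thesis using True by (simp add: eval_single)
next
  case False
  then have "(\<Prod>u\<in>UNIV. (unit_point z $ u) ^ Poly_Mapping.lookup m u) = (0 :: 'k)"
    by (intro prod_zero bexI[of _ z]) auto
  then show ?thesis using False by (simp add: eval_single)
qed

lemma mixed_monomial_in_frame_ideal:
  "mixed m \<Longrightarrow> Poly_Mapping.lookup m z \<noteq> 0 \<Longrightarrow> Poly_Mapping.single m c \<in> frame_ideal z"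
  by (rule frame_idealI) (auto simp: eval_single_scale eval_axis_single eval_unit_single mixed_def)

lemma mixed_difference_in_frame_ideal:
  assumes "mixed m" "mixed m'" "Poly_Mapping.lookup m z = 0" "Poly_Mapping.lookup m' z = 0"
    "mdeg m = mdeg m'"
  shows "Poly_Mapping.single m c - Poly_Mapping.single m' c \<in> frame_ideal z"
  by (rule frame_idealI)
     (use assms in \<open>auto simp: eval_single_scale eval_axis_single eval_unit_single mixed_def\<close>)

text \<open>
  On the line over \<open>e\<^sub>v\<close> a polynomial is the sum of its terms \<open>c x\<^sub>v\<^sup>d\<close>, so elements of \<open>J\<close>
  have no such terms.
\<close>
lemma frame_ideal_keys_mixed:
  fixes F :: "('v::finite, 'k::field) mpoly"
  assumes inf: "infinite (UNIV :: 'k set)" and F: "F \<in> frame_ideal z" and m: "m \<in> Poly_Mapping.keys F"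
  shows "mixed m"
  unfolding mixed_def
proof (intro allI notI)
  fix v assume pm: "pure v m"
  let ?S = "{k. k \<in> Poly_Mapping.keys F \<and> mdeg k = mdeg m}"
  have "0 = (\<Sum>k\<in>?S. if pure v k then Poly_Mapping.lookup F k else 0)"
    using homogeneous_components_vanish[OF inf frame_idealD(1)[OF F, where v = v], where d = "mdeg m"]
    by (simp add: eval_axis_single)
  also have "\<dots> = (\<Sum>k\<in>?S. if k = m then Poly_Mapping.lookup F m else 0)"
    by (intro sum.cong) (use pm in \<open>auto dest!: pure_eq_single\<close>)
  also have "\<dots> = Poly_Mapping.lookup F m" using m by simp
  finally show False using m by (simp add: in_keys_iff)
qed

lemma frame_ideal_unit_sum:
  fixes F :: "('v::finite, 'k::field) mpoly"
  assumes inf: "infinite (UNIV :: 'k set)" and F: "F \<in> frame_ideal z"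
  shows "(\<Sum>k | k \<in> Poly_Mapping.keys F \<and> mdeg k = d.
    if Poly_Mapping.lookup k z = 0 then Poly_Mapping.lookup F k else 0) = 0"
  using homogeneous_components_vanish[OF inf frame_idealD(2)[OF F], where d = d]
  by (simp add: eval_unit_single)

lemma mixed_remove_variable:
  assumes "mixed m" "mdeg m \<ge> 3"
  obtains v k where "m = Poly_Mapping.single v 1 + k" "mixed k"
proof -
  obtain a b where ab: "a \<noteq> b" "Poly_Mapping.lookup m a \<noteq> 0" "Poly_Mapping.lookup m b \<noteq> 0"
    using assms(1) by (rule mixedE)
  have "\<exists>v. Poly_Mapping.lookup m v > (if v = a \<or> v = b then 1 else 0)"
  proof (rule ccontr)
    assume "\<not> ?thesis"
    then have "Poly_Mapping.lookup m v \<le> (if v = a \<or> v = b then 1 else 0)" for v by (meson not_less)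
    then have "mdeg m \<le> (\<Sum>v\<in>UNIV. if v = a \<or> v = b then 1 else 0)"
      unfolding mdeg_def by (intro sum_mono)
    also have "\<dots> = (\<Sum>v\<in>{a, b}. 1)" by (rule sum.mono_neutral_cong_right) auto
    finally show False using assms(2) ab(1) by simp
  qed
  then obtain v where v: "Poly_Mapping.lookup m v > (if v = a \<or> v = b then 1 else 0)" by blast
  let ?k = "m - Poly_Mapping.single v 1"
  have "m = Poly_Mapping.single v 1 + ?k"
    using v by (intro poly_mapping_eqI) (auto simp: lookup_add lookup_minus lookup_single when_def split: if_splits)
  moreover have "mixed ?k"
    by (rule mixedI[OF ab(1)]) (use v ab in \<open>auto simp: lookup_minus lookup_single when_def split: if_splits\<close>)
  ultimately show ?thesis by (rule that)
qed

definition canon :: "'v \<Rightarrow> 'v \<Rightarrow> nat \<Rightarrow> ('v::finite \<Rightarrow>\<^sub>0 nat)" where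
  "canon a b d = Poly_Mapping.single a (d - 1) + Poly_Mapping.single b 1"

text \<open>
  This says that, modulo \<open>J\<close> times the expected weight, mixed monomials in the base variables depend on
  their degree only. Differences of mixed cubics are in \<open>J\<close>, and they suffice: if \<open>m = x\<^sub>v k\<close> with \<open>k\<close> mixed
  of degree \<open>d\<close>, then \<open>m \<equiv> x\<^sub>v x\<^sub>a\<^bsup>d-1\<^esup> x\<^sub>b\<close> by induction, and
  \<open>x\<^sub>v x\<^sub>a x\<^sub>b \<equiv> x\<^sub>a\<^sup>2 x\<^sub>b\<close> finishes the step. Starting at degree \<open>3\<close> covers \<open>n = 2\<close>, where \<open>J\<close> contains no
  quadric in the base variables alone.
\<close>
lemma mixed_congruent_canon:
  fixes m :: "'v::finite \<Rightarrow>\<^sub>0 nat" and w :: "'v \<Rightarrow> nat"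
  assumes ab: "a \<noteq> b" "a \<noteq> z" "b \<noteq> z" and w: "\<And>v. v \<noteq> z \<Longrightarrow> w v = n"
  shows "mixed m \<Longrightarrow> Poly_Mapping.lookup m z = 0 \<Longrightarrow> mdeg m = d + 3 \<Longrightarrow>
    Poly_Mapping.single m 1 - Poly_Mapping.single (canon a b (d + 3)) 1
      \<in> ideal_mult (frame_ideal z :: ('v, 'k::field) mpoly set) (filt w (n * d))"
proof (induction d arbitrary: m)
  case 0
  have "Poly_Mapping.single m 1 - Poly_Mapping.single (canon a b 3) 1 \<in> (frame_ideal z :: ('v, 'k) mpoly set)"
    using 0 ab
    by (intro mixed_difference_in_frame_ideal)
       (auto simp: canon_def mdeg_add lookup_add lookup_single when_def intro!: mixedI[of a b])
  then have "(Poly_Mapping.single m 1 - Poly_Mapping.single (canon a b 3) 1) * 1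
      \<in> ideal_mult (frame_ideal z :: ('v, 'k) mpoly set) (filt w (n * 0))"
    by (intro ideal_mult_memI) (simp_all add: filt_0)
  then show ?case by simp
next
  case (Suc d)
  let ?M = "ideal_mult (frame_ideal z :: ('v, 'k) mpoly set) (filt w (n * Suc d))"
  obtain v k where vk: "m = Poly_Mapping.single v 1 + k" "mixed k"
    using mixed_remove_variable[of m] Suc.prems by auto
  have k: "Poly_Mapping.lookup k z = 0" "mdeg k = d + 3" "v \<noteq> z"
    using Suc.prems vk by (auto simp: lookup_add mdeg_add lookup_single)
  have 1: "Var v * (Poly_Mapping.single k 1 - Poly_Mapping.single (canon a b (d + 3)) 1) \<in> ?M"
    using ideal_mult_filt[OF Suc.IH[OF vk(2) k(1,2)], of "Var v" n] w[OF k(3)]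
    by (simp add: single_in_filt add.commute)
  let ?s = "Poly_Mapping.single v 1 + (Poly_Mapping.single a 1 + Poly_Mapping.single b 1)"
  let ?t = "Poly_Mapping.single a 2 + Poly_Mapping.single b 1"
  have "Poly_Mapping.single ?s 1 - Poly_Mapping.single ?t 1 \<in> (frame_ideal z :: ('v, 'k) mpoly set)"
    using ab k
    by (intro mixed_difference_in_frame_ideal)
       (auto simp: mdeg_add lookup_add lookup_single when_def intro!: mixedI[of a b])
  then have 2: "(Poly_Mapping.single ?s 1 - Poly_Mapping.single ?t 1) * Poly_Mapping.single (Poly_Mapping.single a (d + 1)) 1 \<in> ?M"
    by (rule ideal_mult_memI) (simp add: single_in_filt w[OF ab(2)])
  have s: "?s + Poly_Mapping.single a (d + 1) = Poly_Mapping.single v 1 + canon a b (d + 3)"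
    by (rule poly_mapping_eqI) (simp add: canon_def lookup_add lookup_single when_def)
  have t: "?t + Poly_Mapping.single a (d + 1) = canon a b (Suc d + 3)"
    by (rule poly_mapping_eqI) (simp add: canon_def lookup_add lookup_single when_def)
  have "Poly_Mapping.single m 1 - Poly_Mapping.single (canon a b (Suc d + 3)) 1 =
      Var v * (Poly_Mapping.single k 1 - Poly_Mapping.single (canon a b (d + 3)) 1) +
      (Poly_Mapping.single ?s 1 - Poly_Mapping.single ?t 1) * Poly_Mapping.single (Poly_Mapping.single a (d + 1)) (1 :: 'k)"
    unfolding left_diff_distrib right_diff_distrib mult_single s t vk(1) by simp
  then show ?case using ideal.subspace_add[OF subspace_ideal_mult 1 2] by simp
qed

lemma wt_eq_mdeg:
  assumes w: "\<And>v. v \<noteq> z \<Longrightarrow> w v = n" and "Poly_Mapping.lookup m z = 0"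
  shows "wt w m = n * mdeg m"
  unfolding wt_def mdeg_def sum_distrib_left
  by (intro sum.cong refl) (metis assms mult_0_right)

lemma mixed_split_z:
  assumes "mixed m" "Poly_Mapping.lookup m z \<noteq> 0"
  obtains v k where "v \<noteq> z" "m = (Poly_Mapping.single z 1 + Poly_Mapping.single v 1) + k"
proof -
  obtain v where v: "v \<noteq> z" "Poly_Mapping.lookup m v \<noteq> 0"
    using assms(1) unfolding mixed_def pure_def by blast
  have "m = (Poly_Mapping.single z 1 + Poly_Mapping.single v 1) +
      (m - (Poly_Mapping.single z 1 + Poly_Mapping.single v 1))"
    using v assms(2) by (intro poly_mapping_eqI) (auto simp: lookup_add lookup_minus lookup_single when_def)
  then show ?thesis using v(1) that by blast
qed

lemma two_more_elements:
  assumes "CARD('v::finite) \<ge> 3"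
  obtains a b where "a \<noteq> b" "a \<noteq> (z :: 'v)" "b \<noteq> z"
proof -
  have "card (UNIV - {z}) \<ge> 2" using assms by simp
  then obtain S where S: "S \<subseteq> UNIV - {z}" "card S = 2" by (rule obtain_subset_with_card_n)
  then obtain a b where "S = {a, b}" "a \<noteq> b" by (auto simp: card_2_iff)
  then show ?thesis using S(1) that by blast
qed

text \<open>
  Modulo the right-hand side, terms of \<open>F\<close> that involve \<open>z\<close> vanish, since they are mixed and thus
  multiples of some \<open>x\<^sub>z x\<^sub>v \<in> J\<close>; every other term can be replaced by its coefficient times the standard
  monomial of its degree. In each degree the coefficients of the latter add up to the value of a
  homogeneous component of \<open>F\<close> at \<open>u\<close>, which is zero.
\<close>
lemma frame_ideal_Int_filt:
  fixes z :: "'v::finite"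
  assumes inf: "infinite (UNIV :: 'k::field set)" and card: "CARD('v) \<ge> 3"
    and w: "w z = e" "\<And>v. v \<noteq> z \<Longrightarrow> w v = n" and ne: "n \<ge> 2" "e \<ge> 3" and N: "n * e \<le> N"
  shows "(frame_ideal z :: ('v, 'k) mpoly set) \<inter> filt w N \<subseteq> ideal_mult (frame_ideal z) (filt w (N - n * e))"
proof
  fix F :: "('v, 'k) mpoly" assume F: "F \<in> frame_ideal z \<inter> filt w N"
  let ?M = "ideal_mult (frame_ideal z :: ('v, 'k) mpoly set) (filt w (N - n * e))"
  obtain a b where ab: "a \<noteq> b" "a \<noteq> z" "b \<noteq> z" using card by (rule two_more_elements)
  define h :: "('v \<Rightarrow>\<^sub>0 nat) \<Rightarrow> ('v, 'k) mpoly" where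
    "h k = (if Poly_Mapping.lookup k z = 0
      then Const (Poly_Mapping.lookup F k) * Poly_Mapping.single (canon a b (mdeg k)) 1 else 0)" for k
  have each: "Poly_Mapping.single m (Poly_Mapping.lookup F m) - h m \<in> ?M" if m: "m \<in> Poly_Mapping.keys F" for m
  proof -
    have mix: "mixed m" using frame_ideal_keys_mixed[OF inf _ m] F by blast
    have wt: "N \<le> wt w m" using F m by (auto simp: filt_def)
    show ?thesis
    proof (cases "Poly_Mapping.lookup m z = 0")
      case True
      then have "wt w m = n * mdeg m" using w(2) by (intro wt_eq_mdeg) auto
      then have d: "N \<le> n * mdeg m" using wt by simp
      with N have "n * e \<le> n * mdeg m" by (rule le_trans)
      then have "mdeg m \<ge> 3" using ne by simp
      then obtain d where md: "mdeg m = d + 3" by (metis le_iff_add add.commute)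
      have "n * 3 \<le> n * e" using ne(2) by (rule mult_le_mono2)
      moreover have "N \<le> n * d + n * 3" using d unfolding md distrib_left .
      ultimately have "N - n * e \<le> n * d" by linarith
      then have "filt w (n * d) \<subseteq> (filt w (N - n * e) :: ('v, 'k) mpoly set)" by (rule filt_antimono)
      then have "ideal_mult (frame_ideal z) (filt w (n * d)) \<subseteq> ?M" by (rule ideal_mult_mono)
      then have "Poly_Mapping.single m 1 - Poly_Mapping.single (canon a b (d + 3)) 1 \<in> ?M"
        by (rule subsetD) (rule mixed_congruent_canon[OF ab w(2) mix True md])
      then have "Const (Poly_Mapping.lookup F m) *
          (Poly_Mapping.single m 1 - Poly_Mapping.single (canon a b (d + 3)) 1) \<in> ?M"
        by (rule ideal.subspace_scale[OF subspace_ideal_mult])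
      then show ?thesis using True md by (simp add: h_def right_diff_distrib mult_single)
    next
      case False
      obtain v k where vk: "v \<noteq> z" "m = (Poly_Mapping.single z 1 + Poly_Mapping.single v 1) + k"
        using mixed_split_z[OF mix False] .
      have "Poly_Mapping.single (Poly_Mapping.single z 1 + Poly_Mapping.single v 1) 1 \<in> (frame_ideal z :: ('v, 'k) mpoly set)"
        using vk(1) by (intro mixed_monomial_in_frame_ideal mixedI[of z v]) (auto simp: lookup_add lookup_single)
      moreover have "N - n * e \<le> wt w k"
      proof -
        have "wt w m = e + n + wt w k" using vk w by (simp add: wt_add)
        moreover have "e + n \<le> n * e"
        proof -
          obtain n' e' where "n = n' + 2" "e = e' + 3" using ne by (metis le_iff_add add.commute)
          then show ?thesis by (simp add: algebra_simps)
        qed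
        ultimately show ?thesis using wt by simp
      qed
      ultimately have "Poly_Mapping.single (Poly_Mapping.single z 1 + Poly_Mapping.single v 1) 1 *
          Poly_Mapping.single k (Poly_Mapping.lookup F m) \<in> ?M"
        by (intro ideal_mult_memI single_in_filt)
      then show ?thesis using False vk(2) by (simp add: h_def mult_single)
    qed
  qed
  have "(\<Sum>m\<in>Poly_Mapping.keys F. h m) = 0"
  proof -
    have "(\<Sum>m\<in>Poly_Mapping.keys F. h m) =
        (\<Sum>d\<in>mdeg ` Poly_Mapping.keys F. \<Sum>m | m \<in> Poly_Mapping.keys F \<and> mdeg m = d. h m)"
      by (rule sum.image_gen) simp
    also have "\<dots> = 0"
    proof (rule sum.neutral, rule ballI)
      fix d
      have "(\<Sum>m | m \<in> Poly_Mapping.keys F \<and> mdeg m = d. h m) =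
        (\<Sum>m | m \<in> Poly_Mapping.keys F \<and> mdeg m = d.
          Const (if Poly_Mapping.lookup m z = 0 then Poly_Mapping.lookup F m else 0) * Poly_Mapping.single (canon a b d) 1)"
        by (intro sum.cong) (auto simp: h_def)
      also have "\<dots> = Const (\<Sum>m | m \<in> Poly_Mapping.keys F \<and> mdeg m = d.
          if Poly_Mapping.lookup m z = 0 then Poly_Mapping.lookup F m else 0) * Poly_Mapping.single (canon a b d) 1"
      proof -
        interpret C: comm_ring_hom "Const :: 'k \<Rightarrow> ('v, 'k) mpoly" by (rule comm_ring_hom_Const)
        show ?thesis by (simp only: C.hom_sum sum_distrib_right)
      qed
      also have "\<dots> = 0" using frame_ideal_unit_sum[OF inf, of F z d] F by simp
      finally show "(\<Sum>m | m \<in> Poly_Mapping.keys F \<and> mdeg m = d. h m) = 0" .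
    qed
    finally show ?thesis .
  qed
  then have "F = (\<Sum>m\<in>Poly_Mapping.keys F. Poly_Mapping.single m (Poly_Mapping.lookup F m) - h m)"
    by (simp only: sum_subtractf diff_zero poly_mapping_sum_single[symmetric])
  also have "\<dots> \<in> ?M" by (intro ideal.subspace_sum[OF subspace_ideal_mult] each)
  finally show "F \<in> ?M" .
qed

section \<open>The Jacobian ideal of the frame\<close>

text \<open>
  The least degree in which all monomials in the base variables lie in \<open>(J, I\<^sub>n(\<Theta>))\<close>.
\<close>
definition top_degree :: "nat \<Rightarrow> nat" where
  "top_degree n = (if n = 2 then 3 else n)"

definition frame_weight :: "nat \<Rightarrow> 'v \<Rightarrow> 'v \<Rightarrow> nat" where
  "frame_weight n z v = (if v = z then top_degree n else n)"

lemma wt_frame_weight: "Poly_Mapping.lookup m z = 0 \<Longrightarrow> wt (frame_weight n z) m = n * mdeg m"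
  by (rule wt_eq_mdeg) (simp_all add: frame_weight_def)

lemma mixed_mdeg: "mixed m \<Longrightarrow> mdeg m \<ge> 2"
proof -
  assume "mixed m"
  then obtain a b where ab: "a \<noteq> b" "Poly_Mapping.lookup m a \<noteq> 0" "Poly_Mapping.lookup m b \<noteq> 0"
    by (rule mixedE)
  have "2 \<le> (\<Sum>v\<in>{a, b}. Poly_Mapping.lookup m v)" using ab by simp
  also have "\<dots> \<le> mdeg m" unfolding mdeg_def by (rule sum_mono2) auto
  finally show ?thesis .
qed

lemma mixed_quadric_unique:
  fixes m :: "'v::finite \<Rightarrow>\<^sub>0 nat"
  assumes card: "CARD('v) = 3" and m: "mixed m" "Poly_Mapping.lookup m z = 0" "mdeg m = 2"
    and v: "v \<noteq> z"
  shows "Poly_Mapping.lookup m v = 1"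
proof -
  obtain a b where ab: "a \<noteq> b" "Poly_Mapping.lookup m a \<noteq> 0" "Poly_Mapping.lookup m b \<noteq> 0"
    using m(1) by (rule mixedE)
  have z: "a \<noteq> z" "b \<noteq> z" using ab m(2) by auto
  have "card {a, b, z} = CARD('v)" using ab(1) z card by simp
  then have U: "UNIV = {a, b, z}" by (metis card_subset_eq finite subset_UNIV)
  have "mdeg m = Poly_Mapping.lookup m a + Poly_Mapping.lookup m b + Poly_Mapping.lookup m z"
    unfolding mdeg_def U using ab(1) z by simp
  then have "Poly_Mapping.lookup m a = 1 \<and> Poly_Mapping.lookup m b = 1" using ab m by linarith
  moreover have "v = a \<or> v = b" using U v by blast
  ultimately show ?thesis by blast
qed

text \<open>
  Monomials of elements of \<open>J\<close> are mixed. Those with \<open>z\<close> have at least the weight of \<open>x\<^sub>z x\<^sub>v\<close>, and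
  the others have weight at least \<open>2 n\<close>. This is enough for \<open>n \<ge> 3\<close>. For \<open>n = 2\<close> the product of the two base
  variables must be excluded: it is the only mixed quadric without \<open>z\<close>, so its coefficient is
  the value at \<open>u\<close> of the component of degree \<open>2\<close>, which is zero.
\<close>
lemma frame_ideal_subset_filt:
  fixes z :: "'v::finite"
  assumes inf: "infinite (UNIV :: 'k::field set)" and card: "CARD('v) = n + 1" and n: "n \<ge> 2"
  shows "(frame_ideal z :: ('v, 'k) mpoly set) \<subseteq> filt (frame_weight n z) (n + top_degree n)"
  unfolding filt_def
proof (intro subsetI CollectI ballI)
  fix F :: "('v, 'k) mpoly" and m assume F: "F \<in> frame_ideal z" and m: "m \<in> Poly_Mapping.keys F"
  have mix: "mixed m" by (rule frame_ideal_keys_mixed[OF inf F m])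
  show "n + top_degree n \<le> wt (frame_weight n z) m"
  proof (cases "Poly_Mapping.lookup m z = 0")
    case False
    with mix obtain v k where "v \<noteq> z" "m = (Poly_Mapping.single z 1 + Poly_Mapping.single v 1) + k"
      by (rule mixed_split_z)
    then show ?thesis by (simp add: wt_add frame_weight_def)
  next
    case True
    have "n \<noteq> 2 \<or> mdeg m \<noteq> 2"
    proof (rule ccontr)
      assume "\<not> ?thesis"
      then have n2: "n = 2" and d2: "mdeg m = 2" by auto
      let ?S = "{k. k \<in> Poly_Mapping.keys F \<and> mdeg k = 2}"
      have unique: "k = m" if k: "k \<in> ?S" "Poly_Mapping.lookup k z = 0" for k
      proof (rule poly_mapping_eqI)
        fix v
        have mixk: "mixed k" using k(1) by (intro frame_ideal_keys_mixed[OF inf F]) simp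
        have card3: "CARD('v) = 3" and dk: "mdeg k = 2" using card n2 k(1) by simp_all
        show "Poly_Mapping.lookup k v = Poly_Mapping.lookup m v"
        proof (cases "v = z")
          case False
          show ?thesis
            unfolding mixed_quadric_unique[OF card3 mixk k(2) dk False]
              mixed_quadric_unique[OF card3 mix True d2 False] ..
        next
          case eq: True
          show ?thesis unfolding eq k(2) True ..
        qed
      qed
      have "(\<Sum>k\<in>?S. if Poly_Mapping.lookup k z = 0 then Poly_Mapping.lookup F k else 0) =
          (\<Sum>k\<in>?S. if k = m then Poly_Mapping.lookup F m else 0)"
      proof (intro sum.cong refl)
        fix k assume "k \<in> ?S"
        then have "Poly_Mapping.lookup k z = 0 \<longleftrightarrow> k = m" using unique[of k] True by blast
        then show "(if Poly_Mapping.lookup k z = 0 then Poly_Mapping.lookup F k else 0) =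
            (if k = m then Poly_Mapping.lookup F m else 0)" by simp
      qed
      also have "\<dots> = Poly_Mapping.lookup F m" using m d2 by simp
      finally show False using frame_ideal_unit_sum[OF inf F, of 2] m by (simp add: in_keys_iff)
    qed
    then have "n * (if n = 2 then 3 else 2) \<le> n * mdeg m" using mixed_mdeg[OF mix] by (intro mult_le_mono2) auto
    also have "n * mdeg m = wt (frame_weight n z) m" by (rule wt_frame_weight[OF True, symmetric])
    finally show ?thesis by (cases "n = 2") (simp_all add: top_degree_def)
  qed
qed

text \<open>
  The derivative by \<open>x\<^sub>v\<close> lowers the weight by at most the weight of \<open>x\<^sub>v\<close>. As the \<open>n\<close> columns are
  distinct, at most one of them belongs to \<open>z\<close>, so the weight of a minor is at least
  \<open>n + (n - 1) e = n e + n - e\<close>, where \<open>e = top_degree n\<close>.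
\<close>
lemma minors_frame_ideal_subset_filt:
  fixes z :: "'v::finite"
  assumes inf: "infinite (UNIV :: 'k::field set)" and card: "CARD('v) = n + 1" and n: "n \<ge> 2"
  shows "minors n (frame_ideal z :: ('v, 'k) mpoly set) UNIV jacobian
    \<subseteq> filt (frame_weight n z) (n * top_degree n + n - top_degree n)"
proof
  fix x assume "x \<in> minors n (frame_ideal z :: ('v, 'k) mpoly set) UNIV jacobian"
  then obtain \<rho> \<gamma> where \<rho>: "\<rho> ` {..<n} \<subseteq> (frame_ideal z :: ('v, 'k) mpoly set)"
    and \<gamma>: "inj_on \<gamma> {..<n}" and x: "x = detf n (\<lambda>i j. pdiff (\<gamma> j) (\<rho> i))"
    unfolding minors_def detf_def jacobian_def by blast
  let ?w = "frame_weight n z"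
  have "x \<in> filt ?w (\<Sum>j<n. n + top_degree n - ?w (\<gamma> j))"
    unfolding x
  proof (rule filt_detf, rule filt_pdiff)
    show "\<rho> i \<in> filt ?w (n + top_degree n)" if "i < n" for i
      using frame_ideal_subset_filt[OF inf card n, of z] \<rho> that by blast
  qed
  moreover have "n * top_degree n + n - top_degree n \<le> (\<Sum>j<n. n + top_degree n - ?w (\<gamma> j))"
  proof -
    have e: "n \<le> top_degree n" using n by (simp add: top_degree_def)
    have "(\<Sum>j<n. n + top_degree n - ?w (\<gamma> j)) = (\<Sum>v\<in>\<gamma> ` {..<n}. n + top_degree n - ?w v)"
      by (simp add: sum.reindex[OF \<gamma>])
    also have "\<dots> = (\<Sum>v\<in>\<gamma> ` {..<n}. if v = z then n else top_degree n)"
      by (intro sum.cong) (auto simp: frame_weight_def)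
    finally have s: "(\<Sum>j<n. n + top_degree n - ?w (\<gamma> j)) = \<dots>" .
    have c: "card (\<gamma> ` {..<n}) = n" using card_image[OF \<gamma>] by simp
    show ?thesis
    proof (cases "z \<in> \<gamma> ` {..<n}")
      case True
      have "card (\<gamma> ` {..<n} - {z}) = n - 1" using True c by simp
      then have "(\<Sum>v\<in>\<gamma> ` {..<n}. if v = z then n else top_degree n) = n + (n - 1) * top_degree n"
        using True by (simp add: sum.remove[of _ z])
      then show ?thesis unfolding s using n by (simp add: diff_mult_distrib)
    next
      case False
      have "(\<Sum>v\<in>\<gamma> ` {..<n}. if v = z then n else top_degree n) = (\<Sum>v\<in>\<gamma> ` {..<n}. top_degree n)"
        by (intro sum.cong) (use False in auto)
      then show ?thesis unfolding s using c e by simp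
    qed
  qed
  ultimately show "x \<in> filt ?w (n * top_degree n + n - top_degree n)" using filt_antimono by blast
qed

text \<open>
  The bound for the minors is smaller than \<open>D = n e\<close> if \<open>n = 2\<close>, but the monomials in the gap are
  harmless. A power \<open>x\<^sub>z\<^sup>d\<close> has weight \<open>e d\<close>, a monomial without \<open>z\<close> has weight \<open>n d\<close>, and by
  \<open>n \<le> e < 2 n\<close> such numbers are at least \<open>n e\<close> as soon as they are at least \<open>n e + n - e\<close>; all other monomials
  are in \<open>J\<close>.
\<close>
lemma filt_subset_frame_ideal_plus_filt:
  fixes z :: "'v::finite"
  assumes n: "n \<ge> 2"
  shows "filt (frame_weight n z) (n * top_degree n + n - top_degree n) \<subseteq>
    ideal.span (frame_ideal z \<union> filt (frame_weight n z) (n * top_degree n) :: ('v, 'k::field) mpoly set)"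
    (is "_ \<subseteq> ?S")
proof
  fix F :: "('v, 'k) mpoly"
  let ?e = "top_degree n" and ?w = "frame_weight n z"
  assume F: "F \<in> filt ?w (n * ?e + n - ?e)"
  have e: "n \<le> ?e" "?e < 2 * n" using n by (auto simp: top_degree_def)
  have "Poly_Mapping.single m (Poly_Mapping.lookup F m) \<in> ?S" if m: "m \<in> Poly_Mapping.keys F" for m
  proof (rule ideal.span_base)
    have wt: "n * ?e + n - ?e \<le> wt ?w m" using F m by (auto simp: filt_def)
    have lift: "n * ?e \<le> a * d" if "n * ?e + n - ?e \<le> a * d" "(a = n \<and> b = ?e) \<or> (a = ?e \<and> b = n)" for a b d
    proof -
      have ab: "n * ?e = a * b" using that(2) by auto
      moreover have "b \<le> d"
      proof (rule ccontr)
        assume "\<not> b \<le> d"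
        then have "Suc d \<le> b" by simp
        then have "a * Suc d \<le> a * b" by (rule mult_le_mono2)
        then have "a * d + a \<le> n * ?e" unfolding ab by simp
        then show False using that e n by auto
      qed
      ultimately show ?thesis by simp
    qed
    consider "mixed m" "Poly_Mapping.lookup m z \<noteq> 0" | "Poly_Mapping.lookup m z = 0" | "pure z m"
      unfolding mixed_def pure_def by metis
    then show "Poly_Mapping.single m (Poly_Mapping.lookup F m) \<in> frame_ideal z \<union> filt ?w (n * ?e)"
    proof cases
      case 1
      then show ?thesis by (simp add: mixed_monomial_in_frame_ideal)
    next
      case 2
      then have "n * ?e \<le> wt ?w m" using wt wt_frame_weight[OF 2, of n] lift[of n "mdeg m" ?e] by simp
      then show ?thesis by (simp add: single_in_filt)
    next
      case 3
      then have "wt ?w m = ?e * mdeg m" using wt_single pure_eq_single[OF 3] by (metis frame_weight_def)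
      then have "n * ?e \<le> wt ?w m" using wt lift[of ?e "mdeg m" n] by simp
      then show ?thesis by (simp add: single_in_filt)
    qed
  qed
  then have "(\<Sum>m\<in>Poly_Mapping.keys F. Poly_Mapping.single m (Poly_Mapping.lookup F m)) \<in> ?S"
    by (rule ideal.span_sum)
  then show "F \<in> ?S" by (simp only: poly_mapping_sum_single[symmetric])
qed

lemma eval_Var_axis: "eval_mpoly (Var u) (t *s axis v 1) = (if u = v then t else (0 :: 'k::field))"
  by (simp add: axis_def)

lemma eval_Var_unit: "eval_mpoly (Var u) (t *s unit_point z) = (if u = z then 0 else (t :: 'k::field))"
  by simp

lemma quadric_through_vertex: "i \<noteq> z \<Longrightarrow> Var z * Var i \<in> (frame_ideal z :: ('v::finite, 'k::field) mpoly set)"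
  by (rule frame_idealI; simp only: eval_mult eval_Var_axis eval_Var_unit; auto)

lemma quadric_in_base:
  assumes "a \<noteq> z" "b \<noteq> z" "c \<noteq> z" "a \<noteq> b" "a \<noteq> c"
  shows "Var a * (Var b - Var c) \<in> (frame_ideal z :: ('v::finite, 'k::field) mpoly set)"
  by (rule frame_idealI; simp only: eval_mult eval_diff eval_Var_axis eval_Var_unit; use assms in auto)

lemma cubic_in_base:
  assumes "a \<noteq> z" "b \<noteq> z" "a \<noteq> b"
  shows "Var a * (Var b * (Var a - Var b)) \<in> (frame_ideal z :: ('v::finite, 'k::field) mpoly set)"
  by (rule frame_idealI; simp only: eval_mult eval_diff eval_Var_axis eval_Var_unit; use assms in auto)

text \<open>
  The quadrics \<open>x\<^sub>z x\<^sub>v\<close>, differentiated by the base variables, give \<open>x\<^sub>z\<close> times the identity matrix.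
\<close>
lemma Var_power_in_jac_ideal:
  fixes z :: "'v::finite"
  assumes card: "CARD('v) = n + 1"
  shows "Var z ^ n \<in> jac_ideal n (frame_ideal z :: ('v, 'k::field) mpoly set)"
proof -
  have "card (UNIV - {z}) = card {..<n}" using card by simp
  then obtain \<gamma> where \<gamma>: "bij_betw \<gamma> {..<n} (UNIV - {z})"
    using finite_same_card_bij[of "{..<n}" "UNIV - {z}"] by auto
  have \<gamma>z: "\<gamma> i \<noteq> z" if "i < n" for i using \<gamma> that by (auto simp: bij_betw_def)
  have \<gamma>inj: "\<gamma> i = \<gamma> j \<longleftrightarrow> i = j" if "i < n" "j < n" for i j
    using \<gamma> that by (auto simp: bij_betw_def inj_on_def)
  let ?f = "\<lambda>i. Var z * Var (\<gamma> i) :: ('v, 'k) mpoly"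
  have entry: "pdiff (\<gamma> j) (?f i) = (if i = j then Var z else 0)" if "i < n" "j < n" for i j
    using \<gamma>z[OF that(2)] \<gamma>inj[OF that] by (auto simp: pdiff_mult pdiff_Var)
  have "detf n (\<lambda>i j. pdiff (\<gamma> j) (?f i)) = (\<Prod>i<n. pdiff (\<gamma> i) (?f i))"
    by (rule detf_upper_triangular) (simp add: entry)
  also have "\<dots> = (\<Prod>i<n. Var z)" by (intro prod.cong) (simp_all add: entry)
  also have "\<dots> = Var z ^ n" by simp
  finally have "detf n (\<lambda>i j. pdiff (\<gamma> j) (?f i)) = Var z ^ n" .
  moreover have "?f i \<in> frame_ideal z" if "i < n" for i
    by (rule quadric_through_vertex[OF \<gamma>z[OF that]])
  ultimately show ?thesis
    using jac_ideal_detI[of n ?f "frame_ideal z" "\<lambda>j. pdiff (\<gamma> j)"] derivation_pdiff by metis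
qed

text \<open>
  The form \<open>g\<close> of degree \<open>e - 1\<close> vanishes at all vertices except \<open>e\<^sub>c\<close> and takes the values
  \<open>1\<close> at \<open>e\<^sub>c\<close> and \<open>-1\<close> at \<open>u\<close>, so that its multiples by variables separate \<open>e\<^sub>c\<close> and \<open>u\<close>.
  It is, for suitable derivations, an \<open>(n - 1) \<times> (n - 1)\<close> determinant for the equations of the points on the hyperplane; a further row for the
  quadric \<open>x\<^sub>z x\<^sub>i\<close> and a further column for the derivative by \<open>x\<^sub>z\<close> multiply it by \<open>x\<^sub>i\<close>.

  For \<open>n = 2\<close>, \<open>g\<close> is a derivative of the cubic \<open>x\<^sub>c x\<^sub>b (x\<^sub>c - x\<^sub>b)\<close>. For \<open>n \<ge> 3\<close>, let \<open>v\<^sub>1, \<dots>, v\<^bsub>n-1\<^esub>\<close> be the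
  base variables other than \<open>c\<close>. The quadrics \<open>x\<^sub>c (x\<^bsub>v k\<^esub> - x\<^bsub>v 1\<^esub>)\<close>, \<open>k \<ge> 2\<close>, are killed by the sum of the
  derivatives by \<open>x\<^bsub>v 1\<^esub>, \<dots>, x\<^bsub>v (n-1)\<^esub>\<close>. With this sum in place of the first of these derivatives, and with
  the remaining quadric \<open>x\<^bsub>v 1\<^esub> (x\<^sub>c - x\<^bsub>v 2\<^esub>)\<close> in the first row, the matrix becomes upper triangular.
\<close>
lemma separating_form:
  fixes z c :: "'v::finite"
  assumes card: "CARD('v) = n + 1" and n: "n \<ge> 2" and c: "c \<noteq> z"
  obtains g :: "('v, 'k::field) mpoly"
  where "\<And>i. i \<noteq> z \<Longrightarrow> Var i * g \<in> jac_ideal n (frame_ideal z)"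
    and "\<And>v t. eval_mpoly g (t *s axis v 1) = (if v = c then t ^ (top_degree n - 1) else 0)"
    and "\<And>t. eval_mpoly g (t *s unit_point z) = - (t ^ (top_degree n - 1))"
proof (cases "n = 2")
  case True
  have "card (UNIV - {z, c}) = 1" using card c True by simp
  then obtain b where b: "UNIV - {z, c} = {b}" by (rule card_1_singletonE)
  then have bz: "b \<noteq> z" "b \<noteq> c" by auto
  define g :: "('v, 'k) mpoly" where "g = Var c * (Var c - Var b - Var b)"
  have "Var i * g \<in> jac_ideal n (frame_ideal z)" if i: "i \<noteq> z" for i
  proof -
    define f :: "nat \<Rightarrow> ('v, 'k) mpoly" where
      "f k = (if k = 0 then Var z * Var i else Var c * (Var b * (Var c - Var b)))" for k
    define \<gamma> where "\<gamma> j = (if j = 0 then z else b)" for j :: nat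
    have "detf n (\<lambda>i j. pdiff (\<gamma> j) (f i)) = (\<Prod>i<n. pdiff (\<gamma> i) (f i))"
      by (rule detf_upper_triangular)
         (use True c bz in \<open>auto simp: f_def \<gamma>_def pdiff_mult pdiff_Var pdiff_diff less_2_cases_iff\<close>)
    also have "\<dots> = pdiff (\<gamma> 0) (f 0) * pdiff (\<gamma> 1) (f 1)"
      unfolding True by (simp add: numeral_2_eq_2)
    also have "pdiff (\<gamma> 0) (f 0) = Var i"
      using i by (simp add: f_def \<gamma>_def pdiff_mult pdiff_Var)
    also have "pdiff (\<gamma> 1) (f 1) = g"
    proof -
      have ring: "x * (y * (0 - 1) + (x - y) * 1) + (y * (x - y)) * 0 = x * (x - y - y)" for x y :: "('v, 'k) mpoly"
        by (simp add: algebra_simps)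
      have "pdiff (\<gamma> 1) (f 1) =
          Var c * (Var b * (0 - 1) + (Var c - Var b) * 1) + (Var b * (Var c - Var b)) * 0"
        using bz by (simp only: f_def \<gamma>_def pdiff_mult pdiff_diff pdiff_Var if_False if_True one_neq_zero simp_thms)
      then show ?thesis unfolding g_def ring .
    qed
    finally have "Var i * g = detf n (\<lambda>i j. pdiff (\<gamma> j) (f i))" ..
    moreover have "f k \<in> frame_ideal z" for k
      using quadric_through_vertex[OF i] cubic_in_base[of c z b] c bz by (cases "k = 0") (simp_all only: f_def, auto)
    ultimately show ?thesis
      using jac_ideal_detI[of n f "frame_ideal z" "\<lambda>j. pdiff (\<gamma> j)"] derivation_pdiff by metis
  qed
  moreover have "eval_mpoly g (t *s axis v 1) = (if v = c then t ^ (top_degree n - 1) else 0)" for v t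
    unfolding g_def eval_mult eval_diff eval_Var_axis
    using True bz by (simp add: top_degree_def power2_eq_square)
  moreover have "eval_mpoly g (t *s unit_point z) = - (t ^ (top_degree n - 1))" for t
    unfolding g_def eval_mult eval_diff eval_Var_unit
    using True bz c by (simp add: top_degree_def power2_eq_square)
  ultimately show ?thesis by (rule that)
next
  case False
  then have n3: "n \<ge> 3" using n by simp
  have "card {1..<n} = card (UNIV - {z, c})" using card c by simp
  then obtain \<gamma>' where \<gamma>': "bij_betw \<gamma>' {1..<n} (UNIV - {z, c})"
    using finite_same_card_bij[of "{1..<n}" "UNIV - {z, c}"] by auto
  define \<gamma> where "\<gamma> j = (if j = 0 then z else \<gamma>' j)" for j
  have \<gamma>zc: "\<gamma> j \<noteq> z" "\<gamma> j \<noteq> c" if "1 \<le> j" "j < n" for j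
  proof -
    have "\<gamma>' j \<in> UNIV - {z, c}" using that by (intro bij_betw_apply[OF \<gamma>']) simp
    moreover have "\<gamma> j = \<gamma>' j" using that by (simp add: \<gamma>_def)
    ultimately show "\<gamma> j \<noteq> z" "\<gamma> j \<noteq> c" by simp_all
  qed
  have \<gamma>inj: "\<gamma> j = \<gamma> k \<longleftrightarrow> j = k" if "1 \<le> j" "j < n" "1 \<le> k" "k < n" for j k
    using inj_on_eq_iff[OF bij_betw_imp_inj_on[OF \<gamma>'], of j k] that by (simp add: \<gamma>_def)
  define g :: "('v, 'k) mpoly" where "g = (Var c - Var (\<gamma> 2) - Var (\<gamma> 1)) * Var c ^ (n - 2)"
  have "Var i * g \<in> jac_ideal n (frame_ideal z)" if i: "i \<noteq> z" for i
  proof -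
    define f :: "nat \<Rightarrow> ('v, 'k) mpoly" where
      "f k = (if k = 0 then Var z * Var i else if k = 1 then Var (\<gamma> 1) * (Var c - Var (\<gamma> 2))
        else Var c * (Var (\<gamma> k) - Var (\<gamma> 1)))" for k
    \<comment> \<open>The derivation with index 0 is the derivative by \<open>z\<close>, because \<open>\<gamma> 0 = z\<close>.\<close>
    define \<delta> :: "nat \<Rightarrow> ('v, 'k) mpoly \<Rightarrow> ('v, 'k) mpoly" where
      "\<delta> j = (if j = 1 then (\<lambda>F. \<Sum>v\<in>UNIV - {z, c}. pdiff v F) else pdiff (\<gamma> j))" for j
    have \<delta>: "derivation (\<delta> j)" for j
      unfolding \<delta>_def by (auto intro: derivation_sum derivation_pdiff)
    have \<delta>1: "\<delta> 1 (Var u) = (if u = z \<or> u = c then 0 else 1)" for u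
      by (simp add: \<delta>_def pdiff_Var)
    have \<delta>j: "\<delta> j (Var u) = (if u = \<gamma> j then 1 else 0)" if "j \<noteq> 1" for j u
      using that by (simp add: \<delta>_def pdiff_Var)
    note rules = derivation_mult[OF \<delta>] derivation_diff[OF \<delta>]
    have tri: "\<delta> j (f k) = 0" if jk: "j < k" "k < n" for j k
    proof (cases "k = 1")
      case True
      then show ?thesis
        using jk c \<gamma>zc[of 1] \<gamma>zc[of 2] n3 by (simp add: f_def rules \<delta>j) (simp add: \<gamma>_def)
    next
      case False
      then have f: "f k = Var c * (Var (\<gamma> k) - Var (\<gamma> 1))" using jk by (simp add: f_def)
      have "\<delta> j (Var c) = 0 \<and> \<delta> j (Var (\<gamma> k)) = \<delta> j (Var (\<gamma> 1))"
      proof (cases "j = 1")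
        case True
        then show ?thesis using \<delta>1 \<gamma>zc[of k] \<gamma>zc[of 1] jk by simp
      next
        case j1: False
        show ?thesis
        proof (cases "j = 0")
          case True
          then show ?thesis using \<delta>j[of 0] c \<gamma>zc[of k] \<gamma>zc[of 1] jk by (simp add: \<gamma>_def)
        next
          case False
          then show ?thesis
            using \<delta>j[OF j1] \<gamma>zc[of j] \<gamma>inj[of k j] \<gamma>inj[of 1 j] j1 jk by auto
        qed
      qed
      then show ?thesis unfolding f rules by simp
    qed
    have diag: "\<delta> j (f j) = (if j = 0 then Var i else if j = 1 then Var c - Var (\<gamma> 2) - Var (\<gamma> 1) else Var c)"
      if j: "j < n" for j
    proof -
      consider "j = 0" | "j = 1" | "j \<ge> 2" by linarith
      then show ?thesis
      proof cases
        case 1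
        have "\<gamma> 0 = z" by (simp add: \<gamma>_def)
        then show ?thesis unfolding 1 using i by (simp add: f_def rules \<delta>j)
      next
        case 2
        have "\<delta> 1 (Var (\<gamma> 1)) = 1" "\<delta> 1 (Var (\<gamma> 2)) = 1" "\<delta> 1 (Var c) = 0"
          using n3 \<gamma>zc[of 1] \<gamma>zc[of 2] \<delta>1 by simp_all
        moreover have "f 1 = Var (\<gamma> 1) * (Var c - Var (\<gamma> 2))" by (simp add: f_def)
        moreover have "x * (0 - 1) + y * 1 = y - x" for x y :: "('v, 'k) mpoly" by simp
        ultimately show ?thesis unfolding 2 by (simp only: rules) simp
      next
        case 3
        then have "\<delta> j (Var c) = 0" "\<delta> j (Var (\<gamma> j)) = 1" "\<delta> j (Var (\<gamma> 1)) = 0"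
          using j \<delta>j[of j] \<gamma>zc[of j] \<gamma>inj[of 1 j] by auto
        moreover have "f j = Var c * (Var (\<gamma> j) - Var (\<gamma> 1))" using 3 by (simp add: f_def)
        ultimately show ?thesis using 3 by (simp only: rules) simp
      qed
    qed
    have "detf n (\<lambda>i j. \<delta> j (f i)) = (\<Prod>j<n. \<delta> j (f j))"
      by (rule detf_upper_triangular) (rule tri)
    also have "\<dots> = (\<Prod>j<n. if j = 0 then Var i else if j = 1 then Var c - Var (\<gamma> 2) - Var (\<gamma> 1) else Var c)"
      by (intro prod.cong) (simp_all add: diag)
    also have "{..<n} = {0, 1} \<union> {2..<n}" using n3 by auto
    also have "(\<Prod>j\<in>{0, 1} \<union> {2..<n}. if j = 0 then Var i else if j = 1 then Var c - Var (\<gamma> 2) - Var (\<gamma> 1) else Var c)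
      = (\<Prod>j\<in>{0, 1 :: nat}. if j = 0 then Var i else Var c - Var (\<gamma> 2) - Var (\<gamma> 1)) * (\<Prod>j\<in>{2..<n}. Var c)"
      by (subst prod.union_disjoint) (auto intro!: arg_cong2[of _ _ _ _ "(*)"] prod.cong)
    also have "\<dots> = Var i * g" by (simp add: g_def mult.assoc)
    finally have "Var i * g = detf n (\<lambda>i j. \<delta> j (f i))" ..
    moreover have "f k \<in> frame_ideal z" if "k < n" for k
    proof -
      consider "k = 0" | "k = 1" | "k \<ge> 2" by linarith
      then show ?thesis
      proof cases
        case 1
        then show ?thesis unfolding f_def using quadric_through_vertex[OF i] by simp
      next
        case 2
        have "f k = Var (\<gamma> 1) * (Var c - Var (\<gamma> 2))" using 2 by (simp add: f_def)
        also have "\<dots> \<in> frame_ideal z"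
          by (rule quadric_in_base) (use c n3 \<gamma>zc[of 1] \<gamma>zc[of 2] \<gamma>inj[of 1 2] in auto)
        finally show ?thesis .
      next
        case 3
        then have "f k = Var c * (Var (\<gamma> k) - Var (\<gamma> 1))" by (simp add: f_def)
        also have "\<dots> \<in> frame_ideal z"
          by (rule quadric_in_base) (use 3 that c \<gamma>zc[of 1] \<gamma>zc[of k] in auto)
        finally show ?thesis .
      qed
    qed
    ultimately show ?thesis using jac_ideal_detI[of n f "frame_ideal z" \<delta>] \<delta> by metis
  qed
  moreover have "eval_mpoly g (t *s axis v 1) = (if v = c then t ^ (top_degree n - 1) else 0)" for v t
  proof (cases "v = c")
    case True
    have "top_degree n - 1 = Suc (n - 2)" using n3 by (simp add: top_degree_def)
    then show ?thesis using True n3 \<gamma>zc[of 1] \<gamma>zc[of 2] unfolding g_def eval_mult eval_diff eval_power eval_Var_axis by simp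
  next
    case False
    then show ?thesis using n3 unfolding g_def eval_mult eval_diff eval_power eval_Var_axis by simp
  qed
  moreover have "eval_mpoly g (t *s unit_point z) = - (t ^ (top_degree n - 1))" for t
  proof -
    have "top_degree n - 1 = Suc (n - 2)" using n3 by (simp add: top_degree_def)
    then show ?thesis using c n3 \<gamma>zc[of 1] \<gamma>zc[of 2]
      unfolding g_def eval_mult eval_diff eval_power eval_Var_unit by simp
  qed
  ultimately show ?thesis by (rule that)
qed

text \<open>
  With \<open>g\<close> from \<open>separating_form\<close> for the vertex \<open>c\<close>, the form \<open>x\<^sub>i g\<close>, \<open>i \<notin> {c, z}\<close>, vanishes at all
  vertices and takes the value \<open>-1\<close> at \<open>u\<close>; up to sign it agrees at these points with every mixed monomial of degree \<open>e\<close> in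
  the base variables. In the same way \<open>x\<^sub>c g\<close> is \<open>x\<^sub>c\<^sup>e\<close> minus twice such a monomial modulo \<open>J\<close>.
\<close>
lemma monomial_in_jac_ideal:
  fixes z :: "'v::finite"
  assumes card: "CARD('v) = n + 1" and n: "n \<ge> 2"
    and m: "Poly_Mapping.lookup m z = 0" "mdeg m = top_degree n"
  shows "Poly_Mapping.single m 1 \<in> jac_ideal n (frame_ideal z :: ('v, 'k::field) mpoly set)"
    (is "_ \<in> ?I")
proof -
  let ?e = "top_degree n"
  have subI: "ideal.subspace ?I" by (simp add: jac_ideal_def)
  have JI: "frame_ideal z \<subseteq> ?I" unfolding jac_ideal_def by (auto intro: ideal.span_base)
  have e: "?e > 0" "?e \<ge> 3" using n by (auto simp: top_degree_def)
  have te: "t * t ^ (?e - 1) = t ^ ?e" for t :: 'k using e(1) by (metis Suc_diff_1 power_Suc)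
  have mixed_in: "Poly_Mapping.single k 1 \<in> ?I"
    if k: "mixed k" "Poly_Mapping.lookup k z = 0" "mdeg k = ?e" for k
  proof -
    have "CARD('v) \<ge> 3" using card n by simp
    then obtain c i where ci: "c \<noteq> i" "c \<noteq> z" "i \<noteq> z" by (rule two_more_elements)
    obtain g :: "('v, 'k) mpoly" where g: "\<And>i. i \<noteq> z \<Longrightarrow> Var i * g \<in> ?I"
      "\<And>v t. eval_mpoly g (t *s axis v 1) = (if v = c then t ^ (?e - 1) else 0)"
      "\<And>t. eval_mpoly g (t *s unit_point z) = - (t ^ (?e - 1))"
      using separating_form[OF card n ci(2)] by blast
    have "Var i * g + Poly_Mapping.single k 1 \<in> frame_ideal z"
    proof (rule frame_idealI)
      show "eval_mpoly (Var i * g + Poly_Mapping.single k 1) (t *s axis v 1) = 0" for v and t :: 'k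
        unfolding eval_add eval_mult g(2) eval_Var_axis
        unfolding eval_single_scale eval_axis_single
        using k ci by (auto simp: mixed_def)
      show "eval_mpoly (Var i * g + Poly_Mapping.single k 1) (t *s unit_point z) = 0" for t :: 'k
        unfolding eval_add eval_mult g(3) eval_Var_unit
        unfolding eval_single_scale eval_unit_single
        using k ci te by simp
    qed
    then have "(Var i * g + Poly_Mapping.single k 1) - Var i * g \<in> ?I"
      using JI g(1)[OF ci(3)] by (intro ideal.subspace_diff[OF subI]) blast+
    then show ?thesis by simp
  qed
  show ?thesis
  proof (cases "mixed m")
    case True
    then show ?thesis using m by (intro mixed_in)
  next
    case False
    then obtain c where pc: "pure c m" unfolding mixed_def by blast
    have c: "c \<noteq> z"
    proof
      assume "c = z"
      then have "m = 0" using pc m(1) by (intro poly_mapping_eqI) (metis pure_def lookup_zero)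
      then show False using m(2) e by (simp add: mdeg_def)
    qed
    obtain b where b: "b \<noteq> z" "b \<noteq> c"
    proof -
      have "CARD('v) \<ge> 3" using card n by simp
      then obtain a a' where "a \<noteq> a'" "a \<noteq> z" "a' \<noteq> z" by (rule two_more_elements)
      then show ?thesis using that[of a] that[of a'] by (cases "a = c") auto
    qed
    obtain g :: "('v, 'k) mpoly" where g: "\<And>i. i \<noteq> z \<Longrightarrow> Var i * g \<in> ?I"
      "\<And>v t. eval_mpoly g (t *s axis v 1) = (if v = c then t ^ (?e - 1) else 0)"
      "\<And>t. eval_mpoly g (t *s unit_point z) = - (t ^ (?e - 1))"
      using separating_form[OF card n c] by blast
    define k where "k = canon c b ?e"
    have k: "mixed k" "Poly_Mapping.lookup k z = 0" "mdeg k = ?e"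
      unfolding k_def canon_def using b c e
      by (auto simp: mdeg_add lookup_add lookup_single when_def intro!: mixedI[of c b])
    have "Poly_Mapping.single m 1 - Var c * g - (Poly_Mapping.single k 1 + Poly_Mapping.single k 1) \<in> frame_ideal z"
    proof (rule frame_idealI)
      have "pure v m \<longleftrightarrow> v = c" for v
      proof
        show "v = c" if "pure v m"
        proof (rule ccontr)
          assume "v \<noteq> c"
          then have "m = 0" using pc that by (intro poly_mapping_eqI) (metis pure_def lookup_zero)
          then show False using m(2) e by (simp add: mdeg_def)
        qed
      qed (use pc in simp)
      then show "eval_mpoly (Poly_Mapping.single m 1 - Var c * g - (Poly_Mapping.single k 1 + Poly_Mapping.single k 1))
          (t *s axis v 1) = 0" for v and t :: 'k
        unfolding eval_add eval_diff eval_mult g(2) eval_Var_axis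
        unfolding eval_single_scale eval_axis_single
        using k m te by (auto simp: mixed_def)
      show "eval_mpoly (Poly_Mapping.single m 1 - Var c * g - (Poly_Mapping.single k 1 + Poly_Mapping.single k 1))
          (t *s unit_point z) = 0" for t :: 'k
        unfolding eval_add eval_diff eval_mult g(3) eval_Var_unit
        unfolding eval_single_scale eval_unit_single
        using k m c te by simp
    qed
    then have "(Poly_Mapping.single m 1 - Var c * g - (Poly_Mapping.single k 1 + Poly_Mapping.single k 1))
        + (Var c * g + (Poly_Mapping.single k 1 + Poly_Mapping.single k 1)) \<in> ?I"
      using JI g(1)[OF c] mixed_in[OF k] by (intro ideal.subspace_add[OF subI]) blast+
    then show ?thesis by simp
  qed
qed

lemma monomial_factor:
  fixes m :: "'v::finite \<Rightarrow>\<^sub>0 nat"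
  shows "a \<le> mdeg m \<Longrightarrow> \<exists>k l. m = k + l \<and> mdeg k = a"
proof (induction a)
  case 0
  show ?case by (intro exI[of _ 0] exI[of _ m]) (simp add: mdeg_def)
next
  case (Suc a)
  then obtain k l where kl: "m = k + l" "mdeg k = a" by auto
  then have "mdeg l \<noteq> 0" using Suc.prems by (simp add: mdeg_add)
  then obtain v where v: "Poly_Mapping.lookup l v \<noteq> 0" unfolding mdeg_def by auto
  then have "l = Poly_Mapping.single v 1 + (l - Poly_Mapping.single v 1)"
    by (intro poly_mapping_eqI) (auto simp: lookup_add lookup_minus lookup_single when_def)
  then have "m = (k + Poly_Mapping.single v 1) + (l - Poly_Mapping.single v 1)"
    using kl(1) by (simp add: add.assoc)
  then show ?case using kl(2) by (metis mdeg_add mdeg_single Suc_eq_plus1)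
qed

text \<open>
  The divisors are \<open>x\<^sub>z x\<^sub>v\<close>, \<open>x\<^sub>z\<^sup>n\<close>, or a monomial of degree \<open>e\<close> in the base variables. The last two have
  weight exactly \<open>D = n e\<close>, which is what determines the weights of the variables.
\<close>
lemma monomial_divisor_in_jac_ideal:
  fixes z :: "'v::finite"
  assumes card: "CARD('v) = n + 1" and n: "n \<ge> 2"
    and m: "n * top_degree n \<le> wt (frame_weight n z) m"
  obtains k l where "m = k + l" "Poly_Mapping.single k 1 \<in> jac_ideal n (frame_ideal z :: ('v, 'k::field) mpoly set)"
    "wt (frame_weight n z) k \<le> n * top_degree n"
proof -
  let ?e = "top_degree n" and ?w = "frame_weight n z" and ?I = "jac_ideal n (frame_ideal z :: ('v, 'k) mpoly set)"
  have JI: "frame_ideal z \<subseteq> ?I" unfolding jac_ideal_def by (auto intro: ideal.span_base)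
  have e: "?e > 0" using n by (auto simp: top_degree_def)
  consider "mixed m" "Poly_Mapping.lookup m z \<noteq> 0" | "Poly_Mapping.lookup m z = 0" | "pure z m"
    unfolding mixed_def pure_def by metis
  then show ?thesis
  proof cases
    case 1
    then obtain v l where vl: "v \<noteq> z" "m = (Poly_Mapping.single z 1 + Poly_Mapping.single v 1) + l"
      by (rule mixed_split_z)
    show ?thesis
    proof (rule that[OF vl(2)])
      show "Poly_Mapping.single (Poly_Mapping.single z 1 + Poly_Mapping.single v 1) 1 \<in> ?I"
        using vl(1) by (intro subsetD[OF JI] mixed_monomial_in_frame_ideal mixedI[of z v])
          (auto simp: lookup_add lookup_single)
      have "?e + n \<le> n * ?e"
      proof (cases "n = 2")
        case False
        have "2 * n \<le> n * n" using n by (rule mult_le_mono1)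
        moreover have "?e = n" using False by (simp add: top_degree_def)
        ultimately show ?thesis by (simp only: mult_2)
      qed (simp add: top_degree_def)
      then show "wt ?w (Poly_Mapping.single z 1 + Poly_Mapping.single v 1) \<le> n * ?e"
        using vl(1) by (simp add: wt_add frame_weight_def)
    qed
  next
    case 2
    then have "n * ?e \<le> n * mdeg m" using m by (simp only: wt_frame_weight)
    then have "?e \<le> mdeg m" using n by simp
    then obtain k l where kl: "m = k + l" "mdeg k = ?e" using monomial_factor by blast
    then have kz: "Poly_Mapping.lookup k z = 0" using 2 by (simp add: lookup_add)
    show ?thesis
      using that[OF kl(1) monomial_in_jac_ideal[OF card n kz kl(2)]] wt_frame_weight[OF kz, of n] kl(2) by simp
  next
    case 3
    define d where "d = mdeg m"
    have md: "m = Poly_Mapping.single z d" unfolding d_def by (rule pure_eq_single[OF 3])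
    then have "n * ?e \<le> ?e * d" using m by (simp add: frame_weight_def)
    then have "n \<le> d" using e by simp
    then have "m = Poly_Mapping.single z n + Poly_Mapping.single z (d - n)"
      unfolding md by (simp flip: single_add)
    then show ?thesis
    proof (rule that)
      show "Poly_Mapping.single (Poly_Mapping.single z n) 1 \<in> ?I"
        using Var_power_in_jac_ideal[OF card, of z, where 'k = 'k] unfolding Var_power .
      show "wt ?w (Poly_Mapping.single z n) \<le> n * ?e" by (simp add: frame_weight_def)
    qed
  qed
qed

text \<open>
  Splitting off divisors of weight at most \<open>D\<close> that lie in the ideal, one finds \<open>s\<close> of them in a monomial
  of weight at least \<open>D s\<close>.
\<close>
lemma filt_subset_jac_ideal_pow:
  fixes z :: "'v::finite"
  assumes card: "CARD('v) = n + 1" and n: "n \<ge> 2"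
  shows "filt (frame_weight n z) (n * top_degree n * s) \<subseteq>
    ideal_pow (jac_ideal n (frame_ideal z :: ('v, 'k::field) mpoly set)) s"
proof (induction s)
  case (Suc s)
  let ?D = "n * top_degree n" and ?w = "frame_weight n z" and ?I = "jac_ideal n (frame_ideal z :: ('v, 'k) mpoly set)"
  show ?case
  proof
    fix F :: "('v, 'k) mpoly" assume F: "F \<in> filt ?w (?D * Suc s)"
    have "Poly_Mapping.single m (Poly_Mapping.lookup F m) \<in> ideal_pow ?I (Suc s)"
      if m: "m \<in> Poly_Mapping.keys F" for m
    proof -
      have wt: "?D + ?D * s \<le> wt ?w m" using F m by (auto simp: filt_def)
      then have "?D \<le> wt ?w m" by simp
      then obtain k l where kl: "m = k + l" "Poly_Mapping.single k 1 \<in> ?I" "wt ?w k \<le> ?D"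
        by (rule monomial_divisor_in_jac_ideal[OF card n])
      have "?D * s \<le> wt ?w l" using wt kl unfolding kl(1) wt_add by linarith
      then have "Poly_Mapping.single l (Poly_Mapping.lookup F m) \<in> ideal_pow ?I s"
        by (intro subsetD[OF Suc.IH] single_in_filt)
      then have "Poly_Mapping.single k 1 * Poly_Mapping.single l (Poly_Mapping.lookup F m) \<in> ideal_mult ?I (ideal_pow ?I s)"
        by (rule ideal_mult_memI[OF kl(2)])
      then show ?thesis by (simp add: mult_single kl(1))
    qed
    then have "(\<Sum>m\<in>Poly_Mapping.keys F. Poly_Mapping.single m (Poly_Mapping.lookup F m)) \<in> ideal_pow ?I (Suc s)"
      by (rule ideal.subspace_sum[OF subspace_ideal_pow])
    then show "F \<in> ideal_pow ?I (Suc s)" by (simp only: poly_mapping_sum_single[symmetric])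
  qed
qed simp

lemma jac_ideal_frame_eq:
  fixes z :: "'v::finite"
  assumes inf: "infinite (UNIV :: 'k::field set)" and card: "CARD('v) = n + 1" and n: "n \<ge> 2"
  shows "jac_ideal n (frame_ideal z :: ('v, 'k) mpoly set) =
    ideal.span (frame_ideal z \<union> filt (frame_weight n z) (n * top_degree n))" (is "?I = ?S")
proof
  have J: "ideal.span (frame_ideal z) = (frame_ideal z :: ('v, 'k) mpoly set)" by simp
  have "minors_ideal n (frame_ideal z :: ('v, 'k) mpoly set) UNIV jacobian \<subseteq> ?S"
    unfolding minors_ideal_def
    by (intro ideal.span_minimal ideal.subspace_span
        order_trans[OF minors_frame_ideal_subset_filt[OF inf card n] filt_subset_frame_ideal_plus_filt[OF n]])
  then show "?I \<subseteq> ?S"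
    unfolding span_minors_eq_jac_ideal[OF J, symmetric]
    by (intro ideal.span_minimal ideal.subspace_span Un_least) (auto intro: ideal.span_base)
  have "filt (frame_weight n z) (n * top_degree n) \<subseteq> ideal_mult ?I UNIV"
    using filt_subset_jac_ideal_pow[OF card n, of z 1, where 'k = 'k] by simp
  also have "\<dots> \<subseteq> ?I" by (rule ideal_mult_subset_left) (simp add: jac_ideal_def)
  finally show "?S \<subseteq> ?I"
    by (intro ideal.span_minimal Un_least) (auto simp: jac_ideal_def intro: ideal.span_base)
qed

lemma frame_torsion_free:
  fixes z :: "'v::finite"
  assumes inf: "infinite (UNIV :: 'k::field set)" and card: "CARD('v) = n + 1" and n: "n \<ge> 2"
  shows "aluffi_torsion_free (frame_ideal z :: ('v, 'k) mpoly set) (jac_ideal n (frame_ideal z))"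
proof (rule torsion_free_if_filtration[where W = "filt (frame_weight n z)" and D = "n * top_degree n"])
  show "frame_ideal z \<inter> filt (frame_weight n z) N \<subseteq>
      ideal_mult (frame_ideal z :: ('v, 'k) mpoly set) (filt (frame_weight n z) (N - n * top_degree n))"
    if "n * top_degree n \<le> N" for N
    by (rule frame_ideal_Int_filt[OF inf])
       (use that card n in \<open>auto simp: frame_weight_def top_degree_def\<close>)
  show "F * G \<in> filt (frame_weight n z) (c + d)"
    if "F \<in> filt (frame_weight n z) c" "G \<in> filt (frame_weight n z) d" for F G :: "('v, 'k) mpoly" and c d
    using that by (rule filt_mult)
qed (rule subspace_frame_ideal subspace_filt jac_ideal_frame_eq[OF inf card n] filt_subset_jac_ideal_pow[OF card n])+

section \<open>Points in hyperplane linear position\<close>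

theorem theorem4p4:
  fixes n :: nat
    and \<Gamma> :: "('k::alg_closed_field ^ 'v::finite) set set"
    and J :: "('v, 'k) mpoly set"
    and G :: "('v, 'k) mpoly set"
  assumes "n \<ge> 2"
    and "CARD('v) = n + 1"
    and "card \<Gamma> = n + 2"
    and "hyperplane_linear_position \<Gamma>"
    and "J = defining_ideal \<Gamma>"
    and "minimal_homogeneous_generators G J"
  shows "aluffi_torsion_free J (ideal.span (J \<union> minors_ideal n G UNIV jacobian))"
proof -
  have inf: "infinite (UNIV :: 'k set)" by (rule infinite_UNIV_alg_closed)
  have "n \<ge> 1" using assms(1) by simp
  then obtain A :: "'k ^ 'v ^ 'v" and z where A: "invertible A" "\<Union>\<Gamma> = (*v) A ` frame_cone z"
    using hyperplane_linear_position_obtains_frame[OF assms(2) _ assms(3,4)] by blast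
  then obtain B where AB: "A ** B = Finite_Cartesian_Product.mat 1" "B ** A = Finite_Cartesian_Product.mat 1"
    unfolding invertible_def by blast
  have inv: "lin_subst B (lin_subst A F) = F" "lin_subst A (lin_subst B F) = F" for F
    by (simp_all add: lin_subst_compose AB lin_subst_id)
  have "vec.subspace p" if "p \<in> \<Gamma>" for p
    using assms(4) that unfolding hyperplane_linear_position_def points_of_def by blast
  then have "J = vanishing_ideal (\<Union>\<Gamma>)"
    unfolding assms(5) by (rule defining_ideal_eq_vanishing_ideal[OF inf])
  also have "\<dots> = lin_subst B ` frame_ideal z"
    unfolding A(2) frame_ideal_def by (rule lin_subst_vanishing_ideal[OF AB])
  finally have J: "J = lin_subst B ` frame_ideal z" .
  have "ideal.span (J \<union> minors_ideal n G UNIV jacobian) = jac_ideal n J"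
    using assms(6) unfolding minimal_homogeneous_generators_def by (intro span_minors_eq_jac_ideal) blast
  also have "\<dots> = lin_subst B ` jac_ideal n (frame_ideal z)"
    unfolding J
    by (rule jac_ideal_image[OF comm_ring_hom_lin_subst lin_subst_Const comm_ring_hom_lin_subst
          lin_subst_Const inv, symmetric])
  finally have I: "ideal.span (J \<union> minors_ideal n G UNIV jacobian) = lin_subst B ` jac_ideal n (frame_ideal z)" .
  have "bij (lin_subst B)" by (rule o_bij[of "lin_subst A"]) (auto simp: inv)
  then show ?thesis
    unfolding I unfolding J
    by (intro aluffi_torsion_free_image[OF comm_ring_hom_lin_subst] frame_torsion_free[OF inf assms(2,1)])
qed

end
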